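(* There exist a quasiregular mapping $f:\mathbb{R}^2\to\mathbb{R}^2$ with an essential singularity at infinity and a sequence $(W_k)_{k\ge 0}$ of domains in $\mathbb{R}^2$ such that: each $W_k$ is a wandering component both of $\mathbb{R}^2\setminus\overline{I(f)}$ and of the Fatou set $F(f)$; the set $\bigcup_{k\ge0}W_k$ is bounded; $f(W_k)=W_{k+1}$ for all $k\ge 0$; and, for each fixed $k$, the iterates $f^n$ converge to $0$ uniformly on $W_k$ as $n\to\infty$.
   Context: A continuous function $f:G\to\mathbb{R}^2$ on a domain $G\subseteq\mathbb{R}^2$ is $K$-quasiregular if it belongs to the Sobolev space $W^1_{2,\mathrm{loc}}(G)$ and $|Df(x)|^2\le K J_f(x)$ for almost every $x\in G$, where $Df(x)$ is the formal derivative, $|Df(x)|=\sup_{|a|=1}|Df(x)a|$ is its operator norm, and $J_f(x)$ is the Jacobian determinant. A function is quasiregular if it is $K$-quasiregular for some $K\ge1$. A non-constant quasiregular mapping $f:\mathbb{R}^2\to\mathbb{R}^2$ is of polynomial type if $f(x)\to\infty$ as $x\to\infty$; otherwise $\lim_{x\to\infty}f(x)$ does not exist and $f$ is said to have an essential singularity at infinity. Let $f^n$ denote the $n$-th iterate of $f$. The escaping set is $I(f)=\{x\in\mathbb{R}^2: f^n(x)\to\infty \text{ as } n\to\infty\}$. The Fatou set $F(f)$ is the set of $x\in\mathbb{R}^2$ having a neighbourhood $U$ such that $\{f^n|_U\}$ is a normal family (locally uniform convergence to $\infty$ is allowed, i.e. normality is with respect to the spherical metric on the target). If an open set $U$ is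 completely invariant under $f$, $U_0$ is a connected component of $U$, and $U_n$ denotes the component of $U$ containing $f^n(U_0)$, then $U_0$ is called a wandering component (or wandering domain) of $U$ if $U_n\neq U_m$ whenever $n\neq m$. (The open sets $\mathbb{R}^2\setminus\overline{I(f)}$ and $F(f)$ are completely invariant under $f$.) *)

theory Defs
  imports "HOL-Analysis.Analysis"
begin

definition is_domain :: "(real^2) set \<Rightarrow> bool" where
  "is_domain G \<longleftrightarrow> open G \<and> connected G \<and> G \<noteq> {}"

definition partial :: "2 \<Rightarrow> (real^2 \<Rightarrow> real) \<Rightarrow> real^2 \<Rightarrow> real" where
  "partial j \<phi> x = frechet_derivative \<phi> (at x) (axis j 1)"

primrec C_k :: "nat \<Rightarrow> (real^2 \<Rightarrow> real) \<Rightarrow> bool" where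
  "C_k 0 \<phi> \<longleftrightarrow> continuous_on UNIV \<phi>"
| "C_k (Suc k) \<phi> \<longleftrightarrow> (\<forall>x. \<phi> differentiable (at x)) \<and> (\<forall>j. C_k k (partial j \<phi>))"

definition test_function_on :: "(real^2) set \<Rightarrow> (real^2 \<Rightarrow> real) \<Rightarrow> bool" where
  "test_function_on G \<phi> \<longleftrightarrow>
     (\<forall>k. C_k k \<phi>) \<and> compact (closure {x. \<phi> x \<noteq> 0}) \<and> closure {x. \<phi> x \<noteq> 0} \<subseteq> G"

definition L2_loc :: "(real^2) set \<Rightarrow> (real^2 \<Rightarrow> real) \<Rightarrow> bool" where
  "L2_loc G u \<longleftrightarrow> set_borel_measurable lebesgue G u \<and>
     (\<forall>C. compact C \<and> C \<subseteq> G \<longrightarrow> set_integrable lebesgue C (\<lambda>x. (u x)\<^sup>2))"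

definition weak_partial_on ::
    "(real^2) set \<Rightarrow> 2 \<Rightarrow> (real^2 \<Rightarrow> real) \<Rightarrow> (real^2 \<Rightarrow> real) \<Rightarrow> bool" where
  "weak_partial_on G j u v \<longleftrightarrow>
     (\<forall>\<phi>. test_function_on G \<phi> \<longrightarrow>
        (LINT x:G|lebesgue. u x * partial j \<phi> x) = - (LINT x:G|lebesgue. v x * \<phi> x))"

text \<open>The formal derivative is determined only up to null sets, hence it enters as a relation:
  \<open>D\<close> is a version of the formal derivative of \<open>f \<in> W\<^sup>1\<^sub>2\<^sub>,\<^sub>l\<^sub>o\<^sub>c(G)\<close>. Row \<open>i\<close>, column \<open>j\<close> of \<open>D x\<close>
  is the \<open>j\<close>-th weak partial derivative of the \<open>i\<close>-th component.\<close>

definition formal_derivative_on ::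
    "(real^2) set \<Rightarrow> (real^2 \<Rightarrow> real^2) \<Rightarrow> (real^2 \<Rightarrow> real^2^2) \<Rightarrow> bool" where
  "formal_derivative_on G f D \<longleftrightarrow>
     (\<forall>i. L2_loc G (\<lambda>x. f x $ i)) \<and>
     (\<forall>i j. L2_loc G (\<lambda>x. D x $ i $ j) \<and>
            weak_partial_on G j (\<lambda>x. f x $ i) (\<lambda>x. D x $ i $ j))"

definition K_quasiregular_on :: "real \<Rightarrow> (real^2) set \<Rightarrow> (real^2 \<Rightarrow> real^2) \<Rightarrow> bool" where
  "K_quasiregular_on K G f \<longleftrightarrow> is_domain G \<and> continuous_on G f \<and>
     (\<exists>D. formal_derivative_on G f D \<and>
          (AE x\<in>G in lebesgue. (onorm ((*v) (D x)))\<^sup>2 \<le> K * det (D x)))"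

definition quasiregular_on :: "(real^2) set \<Rightarrow> (real^2 \<Rightarrow> real^2) \<Rightarrow> bool" where
  "quasiregular_on G f \<longleftrightarrow> (\<exists>K\<ge>1. K_quasiregular_on K G f)"

definition polynomial_type :: "(real^2 \<Rightarrow> real^2) \<Rightarrow> bool" where
  "polynomial_type f \<longleftrightarrow> quasiregular_on UNIV f \<and> \<not> f constant_on UNIV \<and>
     filterlim f at_infinity at_infinity"

text \<open>No limit exists in the plane together with the point at infinity. For non-constant
  quasiregular maps the absence of a finite limit is automatic.\<close>

definition essential_singularity_at_infinity :: "(real^2 \<Rightarrow> real^2) \<Rightarrow> bool" where
  "essential_singularity_at_infinity f \<longleftrightarrow> quasiregular_on UNIV f \<and> \<not> f constant_on UNIV \<and>
     \<not> polynomial_type f \<and> (\<nexists>l. (f \<longlongrightarrow> l) at_infinity)"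

definition escaping_set :: "(real^2 \<Rightarrow> real^2) \<Rightarrow> (real^2) set" where
  "escaping_set f = {x. filterlim (\<lambda>n. (f ^^ n) x) at_infinity sequentially}"

text \<open>Inverse stereographic projection onto the unit sphere in \<open>\<real>\<^sup>2 \<times> \<real>\<close>; the point at infinity
  corresponds to \<open>(0, 1)\<close>. The Euclidean distance of two images is the chordal
  distance, which is uniformly equivalent to the spherical one.\<close>

definition to_sphere :: "real^2 \<Rightarrow> (real^2) \<times> real" where
  "to_sphere x =
     ((2 / ((norm x)\<^sup>2 + 1)) *\<^sub>R x, ((norm x)\<^sup>2 - 1) / ((norm x)\<^sup>2 + 1))"

text \<open>The sphere being closed, the limit function \<open>g\<close> below takes values in it on \<open>U\<close>.\<close>

definition normal_family_on :: "(real^2) set \<Rightarrow> (real^2 \<Rightarrow> real^2) set \<Rightarrow> bool" where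
  "normal_family_on U \<F> \<longleftrightarrow>
     (\<forall>h :: nat \<Rightarrow> real^2 \<Rightarrow> real^2. range h \<subseteq> \<F> \<longrightarrow>
        (\<exists>r g. strict_mono (r :: nat \<Rightarrow> nat) \<and>
           (\<forall>x\<in>U. \<exists>V. open V \<and> x \<in> V \<and> V \<subseteq> U \<and>
              uniform_limit V (\<lambda>k y. to_sphere (h (r k) y)) g sequentially)))"

definition fatou_set :: "(real^2 \<Rightarrow> real^2) \<Rightarrow> (real^2) set" where
  "fatou_set f =
     {x. \<exists>U. open U \<and> x \<in> U \<and> normal_family_on U (range (\<lambda>n. f ^^ n))}"

text \<open>\<open>C n\<close> is the component of \<open>U\<close> containing the image of \<open>U\<^sub>0\<close> under the \<open>n\<close>-th iterate. It is
  unique because \<open>U\<^sub>0\<close> is non-empty; for continuous \<open>f\<close> it exists whenever \<open>f\<close> maps \<open>U\<close> into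
  itself, in particular for completely invariant \<open>U\<close>.\<close>

definition wandering_component ::
    "(real^2 \<Rightarrow> real^2) \<Rightarrow> (real^2) set \<Rightarrow> (real^2) set \<Rightarrow> bool" where
  "wandering_component f U U\<^sub>0 \<longleftrightarrow> U\<^sub>0 \<in> components U \<and>
     (\<exists>C :: nat \<Rightarrow> (real^2) set.
        (\<forall>n. C n \<in> components U \<and> (f ^^ n) ` U\<^sub>0 \<subseteq> C n) \<and>
        (\<forall>n m. n \<noteq> m \<longrightarrow> C n \<noteq> C m))"

end

theory Submission
  imports Defs "HOL-Real_Asymp.Real_Asymp"
begin

text \<open>The map is glued from two pieces along the vertical axis. On the right half-plane the horizontal
  coordinate is contracted by the factor \<open>c = exp (- 2 * pi)\<close>. Along the positive horizontal axis lies a chain of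
  lenses, the components of \<open>{(a, b). \<bar>b\<bar> < height a}\<close> with \<open>height a = a * (1 - cos (ln a))\<close>. This chain is
  invariant under multiplication by \<open>c\<close>, and on it the map is multiplication by \<open>c\<close>; hence each lens is carried onto
  the next one and the iterates tend to the origin (\<open>saddle_image_lens\<close>, \<open>uniform_limit_lens\<close>). Outside
  the chain the vertical distance from it is expanded by a factor of at least 3, so all points of the right half-plane
  outside the closed chain escape (\<open>outside_escapes\<close>). Consequently every boundary point of a lens is a limit
  of escaping points (\<open>frontier_lens_escaping\<close>) as well as of points with orbits tending to the origin.
  Such a point lies neither in the complement of the closure of the escaping set nor in the Fatou set, so the
  lenses are full components of both, and they are pairwise disjoint.

  The left half-plane serves only to create the essential singularity: there the map is
  \<open>z \<mapsto> 4 * z + sinh z\<close>, which has zeros arbitrarily far out (\<open>saddle_zero_far_out\<close>) and maps the vertical axis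
  onto itself by a bi-Lipschitz homeomorphism, to which the right half-plane piece is adapted. The right half-plane is
  forward invariant, so the dynamics on the lenses and near their boundaries does not see the other side.

  Quasiregularity is reduced to pointwise calculus: a locally Lipschitz function which is differentiable
  along a coordinate direction almost everywhere has the corresponding weak derivative
  (\<open>weak_partial_of_ae_derivative\<close>), and the exceptional points lie on the vertical axis and
  on two Lipschitz graphs. The derivative
  satisfies the Cauchy-Riemann equations on the left and inside the lenses; elsewhere its entries are bounded and its determinant is
  bounded away from zero (\<open>saddle_dilatation\<close>).\<close>

section \<open>Functions that are Lipschitz on every ball\<close>

definition lipschitz_on_balls :: "('a::real_normed_vector \<Rightarrow> real) \<Rightarrow> bool" where
  "lipschitz_on_balls u \<longleftrightarrow> (\<forall>R. \<exists>L. L-lipschitz_on (cball 0 R) u)"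

lemma lipschitz_on_balls_continuous:
  assumes "lipschitz_on_balls u"
  shows "continuous_on UNIV u"
proof -
  have "isCont u x" for x
  proof -
    obtain L where "L-lipschitz_on (cball 0 (norm x + 1)) u"
      using assms unfolding lipschitz_on_balls_def by blast
    then have "continuous_on (ball 0 (norm x + 1)) u"
      by (meson ball_subset_cball continuous_on_subset lipschitz_on_continuous_on)
    then show ?thesis
      by (simp add: continuous_on_eq_continuous_at)
  qed
  then show ?thesis
    by (simp add: continuous_at_imp_continuous_on)
qed

lemma lipschitz_on_balls_bounded:
  assumes "lipschitz_on_balls u"
  obtains B where "B \<ge> 0" "\<And>x. x \<in> cball 0 R \<Longrightarrow> \<bar>u x\<bar> \<le> B"
proof -
  obtain L where L: "L-lipschitz_on (cball 0 R) u"
    using assms unfolding lipschitz_on_balls_def by blast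
  have "\<bar>u x\<bar> \<le> \<bar>u 0\<bar> + L * \<bar>R\<bar>" if "x \<in> cball 0 R" for x
  proof -
    have "0 \<in> cball (0::'a) R"
      using that norm_ge_zero[of x] by (simp del: norm_ge_zero)
    then have "\<bar>u x - u 0\<bar> \<le> L * norm x"
      using lipschitz_onD[OF L that, of 0] by (simp add: dist_norm)
    also have "\<dots> \<le> L * \<bar>R\<bar>"
      using that lipschitz_on_nonneg[OF L] by (intro mult_left_mono) auto
    finally show ?thesis by linarith
  qed
  then show ?thesis
    using that[of "\<bar>u 0\<bar> + L * \<bar>R\<bar>"] lipschitz_on_nonneg[OF L] by simp
qed

lemma lipschitz_on_balls_add:
  assumes "lipschitz_on_balls u" "lipschitz_on_balls v"
  shows "lipschitz_on_balls (\<lambda>x. u x + v x)"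
  using assms unfolding lipschitz_on_balls_def by (blast intro: lipschitz_on_add)

lemma lipschitz_on_balls_const: "lipschitz_on_balls (\<lambda>x. k)"
  unfolding lipschitz_on_balls_def by (blast intro: lipschitz_on_constant)

lemma lipschitz_on_balls_mult:
  assumes u: "lipschitz_on_balls u" and v: "lipschitz_on_balls v"
  shows "lipschitz_on_balls (\<lambda>x. u x * v x)"
  unfolding lipschitz_on_balls_def
proof
  fix R
  obtain L M where L: "L-lipschitz_on (cball 0 R) u" and M: "M-lipschitz_on (cball 0 R) v"
    using u v unfolding lipschitz_on_balls_def by blast
  obtain A where A: "A \<ge> 0" "\<And>x. x \<in> cball 0 R \<Longrightarrow> \<bar>u x\<bar> \<le> A"
    using lipschitz_on_balls_bounded[OF u] by blast
  obtain B where B: "B \<ge> 0" "\<And>x. x \<in> cball 0 R \<Longrightarrow> \<bar>v x\<bar> \<le> B"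
    using lipschitz_on_balls_bounded[OF v] by blast
  have "(A * M + B * L)-lipschitz_on (cball 0 R) (\<lambda>x. u x * v x)"
  proof (rule lipschitz_onI)
    fix x y :: 'a assume x: "x \<in> cball 0 R" and y: "y \<in> cball 0 R"
    have "u x * v x - u y * v y = u x * (v x - v y) + v y * (u x - u y)"
      by (simp add: algebra_simps)
    then have "\<bar>u x * v x - u y * v y\<bar> \<le> \<bar>u x\<bar> * \<bar>v x - v y\<bar> + \<bar>v y\<bar> * \<bar>u x - u y\<bar>"
      by (metis abs_mult abs_triangle_ineq)
    also have "\<dots> \<le> A * (M * dist x y) + B * (L * dist x y)"
      using A B x y lipschitz_onD[OF L x y] lipschitz_onD[OF M x y]
      by (intro add_mono mult_mono) (auto simp: dist_real_def)
    finally show "dist (u x * v x) (u y * v y) \<le> (A * M + B * L) * dist x y"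
      by (simp add: dist_real_def algebra_simps)
  next
    show "0 \<le> A * M + B * L"
      using A B lipschitz_on_nonneg[OF L] lipschitz_on_nonneg[OF M] by simp
  qed
  then show "\<exists>L. L-lipschitz_on (cball 0 R) (\<lambda>x. u x * v x)" by blast
qed

lemma lipschitz_on_balls_cmult:
  assumes "lipschitz_on_balls u"
  shows "lipschitz_on_balls (\<lambda>x. k * u x)"
  using lipschitz_on_balls_mult[OF lipschitz_on_balls_const assms] .

lemma lipschitz_on_balls_minus:
  assumes "lipschitz_on_balls u"
  shows "lipschitz_on_balls (\<lambda>x. - u x)"
  using lipschitz_on_balls_cmult[OF assms, of "-1"] by simp

lemma lipschitz_on_balls_diff:
  assumes "lipschitz_on_balls u" "lipschitz_on_balls v"
  shows "lipschitz_on_balls (\<lambda>x. u x - v x)"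
  using lipschitz_on_balls_add[OF assms(1) lipschitz_on_balls_minus[OF assms(2)]] by simp

lemma lipschitz_on_balls_compose:
  fixes g :: "real \<Rightarrow> real"
  assumes g: "lipschitz_on_balls g" and u: "lipschitz_on_balls u"
  shows "lipschitz_on_balls (\<lambda>x. g (u x))"
  unfolding lipschitz_on_balls_def
proof
  fix R
  obtain B where B: "\<And>x. x \<in> cball 0 R \<Longrightarrow> \<bar>u x\<bar> \<le> B"
    using lipschitz_on_balls_bounded[OF u] by blast
  obtain L where L: "L-lipschitz_on (cball 0 R) u"
    using u unfolding lipschitz_on_balls_def by blast
  obtain M where "M-lipschitz_on (cball 0 B) g"
    using g unfolding lipschitz_on_balls_def by blast
  then have "M-lipschitz_on (u ` cball 0 R) g"
    by (rule lipschitz_on_subset) (use B in auto)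
  from lipschitz_on_compose2[OF L this]
  show "\<exists>L. L-lipschitz_on (cball 0 R) (\<lambda>x. g (u x))" by blast
qed

lemma lipschitz_imp_on_balls:
  assumes "\<And>x y. \<bar>u x - u y\<bar> \<le> L * norm (x - y)" "L \<ge> 0"
  shows "lipschitz_on_balls u"
  unfolding lipschitz_on_balls_def
  by (intro allI exI[of _ L] lipschitz_onI) (use assms in \<open>auto simp: dist_norm\<close>)

lemma C1_real_lipschitz_on_balls:
  fixes g :: "real \<Rightarrow> real"
  assumes d: "\<And>x. (g has_real_derivative g' x) (at x)" and c: "continuous_on UNIV g'"
  shows "lipschitz_on_balls g"
  unfolding lipschitz_on_balls_def
proof
  fix R :: real
  have "bounded (g' ` cball 0 R)"
    by (intro compact_imp_bounded compact_continuous_image compact_cball continuous_on_subset[OF c]) auto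
  then obtain B where B: "B > 0" "\<And>x. x \<in> cball 0 R \<Longrightarrow> \<bar>g' x\<bar> \<le> B"
    unfolding bounded_pos by auto
  have "B-lipschitz_on (cball 0 R) g"
  proof (rule lipschitz_onI)
    fix x y :: real assume "x \<in> cball 0 R" "y \<in> cball 0 R"
    with field_differentiable_bound[of "cball 0 R" g g' B y x] d B
    show "dist (g x) (g y) \<le> B * dist x y"
      by (simp add: dist_norm has_field_derivative_at_within abs_minus_commute)
  qed (use B in auto)
  then show "\<exists>L. L-lipschitz_on (cball 0 R) g" by blast
qed

section \<open>Weak derivatives of locally Lipschitz functions\<close>

lemma frechet_derivative_eq_partials:
  fixes \<phi> :: "real^2 \<Rightarrow> real"
  assumes "\<phi> differentiable (at x)"
  shows "frechet_derivative \<phi> (at x) v = v $ 1 * partial 1 \<phi> x + v $ 2 * partial 2 \<phi> x"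
proof -
  have l: "linear (frechet_derivative \<phi> (at x))"
    using assms by (simp add: linear_frechet_derivative)
  have "v = v $ 1 *\<^sub>R axis 1 1 + v $ 2 *\<^sub>R axis 2 1"
    by (simp add: vec_eq_iff forall_2 axis_def)
  then have "frechet_derivative \<phi> (at x) v
      = frechet_derivative \<phi> (at x) (v $ 1 *\<^sub>R axis 1 1 + v $ 2 *\<^sub>R axis 2 1)" by simp
  also have "\<dots> = v $ 1 * partial 1 \<phi> x + v $ 2 * partial 2 \<phi> x"
    by (simp add: linear_add[OF l] linear_scale[OF l] partial_def)
  finally show ?thesis .
qed

lemma test_function_C1:
  assumes "test_function_on G \<phi>"
  shows "\<phi> differentiable (at x)" "continuous_on UNIV (partial j \<phi>)"
proof -
  have "C_k (Suc 0) \<phi>" using assms unfolding test_function_on_def by blast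
  then show "\<phi> differentiable (at x)" "continuous_on UNIV (partial j \<phi>)" by simp_all
qed

lemma test_function_lipschitz_on_balls:
  assumes \<phi>: "test_function_on G \<phi>"
  shows "lipschitz_on_balls \<phi>"
  unfolding lipschitz_on_balls_def
proof
  fix R :: real
  have "bounded (partial j \<phi> ` cball 0 R)" for j
    by (intro compact_imp_bounded compact_continuous_image compact_cball
        continuous_on_subset[OF test_function_C1(2)[OF \<phi>]]) auto
  then have "\<exists>B. \<forall>x \<in> cball 0 R. \<bar>partial j \<phi> x\<bar> \<le> B" for j
    unfolding bounded_iff by auto
  then obtain B where B: "\<And>j x. x \<in> cball 0 R \<Longrightarrow> \<bar>partial j \<phi> x\<bar> \<le> B j" by metis
  have "(\<bar>B 1\<bar> + \<bar>B 2\<bar>)-lipschitz_on (cball 0 R) \<phi>"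
  proof (rule bounded_derivative_imp_lipschitz)
    fix x :: "real^2" assume x: "x \<in> cball 0 R"
    show "(\<phi> has_derivative frechet_derivative \<phi> (at x)) (at x within cball 0 R)"
      using test_function_C1(1)[OF \<phi>] frechet_derivative_works has_derivative_at_withinI by blast
    show "onorm (frechet_derivative \<phi> (at x)) \<le> \<bar>B 1\<bar> + \<bar>B 2\<bar>"
    proof (rule onorm_le)
      fix v :: "real^2"
      have "\<bar>v $ 1 * partial 1 \<phi> x + v $ 2 * partial 2 \<phi> x\<bar>
          \<le> \<bar>v $ 1\<bar> * \<bar>partial 1 \<phi> x\<bar> + \<bar>v $ 2\<bar> * \<bar>partial 2 \<phi> x\<bar>"
        by (metis abs_mult abs_triangle_ineq)
      also have "\<dots> \<le> norm v * \<bar>B 1\<bar> + norm v * \<bar>B 2\<bar>"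
        using B[OF x, of 1] B[OF x, of 2] component_le_norm_cart[of v]
        by (intro add_mono mult_mono) auto
      finally show "norm (frechet_derivative \<phi> (at x) v) \<le> (\<bar>B 1\<bar> + \<bar>B 2\<bar>) * norm v"
        by (simp add: frechet_derivative_eq_partials[OF test_function_C1(1)[OF \<phi>]] algebra_simps)
    qed
  qed auto
  then show "\<exists>L. L-lipschitz_on (cball 0 R) \<phi>" by blast
qed

lemma compact_support_integrable:
  fixes w :: "'a::euclidean_space \<Rightarrow> real"
  assumes c: "continuous_on UNIV w" and z: "\<And>x. norm x > R \<Longrightarrow> w x = 0"
  shows "integrable lebesgue w"
proof -
  have "integrable lborel (\<lambda>x. indicator (cball 0 R) x *\<^sub>R w x)"
    by (intro borel_integrable_compact compact_cball continuous_on_subset[OF c]) auto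
  also have "(\<lambda>x. indicator (cball 0 R) x *\<^sub>R w x) = w"
    using z by (auto simp: fun_eq_iff indicator_def not_le)
  finally show ?thesis
    by (simp add: integrable_completion borel_measurable_continuous_onI[OF c])
qed

lemma translation_difference_integral:
  fixes F :: "'a::euclidean_space \<Rightarrow> real"
  assumes c: "continuous_on UNIV F" and z: "\<And>x. norm x > R \<Longrightarrow> F x = 0"
  shows "(LINT x|lebesgue. F (x + e) - F x) = 0"
proof -
  have ce: "continuous_on UNIV (\<lambda>x. F (x + e))"
    by (intro continuous_on_compose2[OF c] continuous_intros) auto
  have "F (x + e) = 0" if "norm x > R + norm e" for x
  proof (rule z)
    show "norm (x + e) > R"
      using that norm_triangle_sub[of x "- e"] by simp
  qed
  then have i: "integrable lebesgue (\<lambda>x. F (x + e))" "integrable lebesgue F"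
    using compact_support_integrable[OF ce, of "R + norm e"] compact_support_integrable[OF c, of R] z by blast+
  have "(LINT x|lebesgue. F (x + e)) = (LINT x|lborel. F (e + x))"
    by (subst integral_completion) (auto simp: borel_measurable_continuous_onI[OF ce] add.commute)
  also have "\<dots> = (LINT x|distr lborel borel ((+) e). F x)"
    by (rule integral_distr[symmetric]) (auto simp: borel_measurable_continuous_onI[OF c])
  also have "\<dots> = (LINT x|lebesgue. F x)"
    by (simp add: lborel_distr_plus integral_completion borel_measurable_continuous_onI[OF c])
  finally show ?thesis using i by simp
qed

text \<open>The derivative in the direction \<open>e\<close> is the limit of difference quotients, whose integrals vanish
  because Lebesgue measure is invariant under translations. The local Lipschitz bound dominates the
  quotients, so the limit may be taken under the integral.\<close>

lemma compact_support_directional_derivative_integral: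
  fixes F w :: "'a::euclidean_space \<Rightarrow> real"
  assumes lip: "lipschitz_on_balls F" and z: "\<And>x. norm x > R \<Longrightarrow> F x = 0"
    and d: "AE x in lebesgue. ((\<lambda>t. F (x + t *\<^sub>R e)) has_real_derivative w x) (at 0)"
    and w: "w \<in> borel_measurable lebesgue"
  shows "integrable lebesgue w" "(LINT x|lebesgue. w x) = 0"
proof -
  define s where "s n x = (F (x + (1 / real (Suc n)) *\<^sub>R e) - F x) / (1 / real (Suc n))"
    for n and x :: 'a
  have c: "continuous_on UNIV F" using lip by (rule lipschitz_on_balls_continuous)
  obtain L where L: "L-lipschitz_on (cball 0 (\<bar>R\<bar> + 2 * norm e)) F"
    using lip unfolding lipschitz_on_balls_def by blast
  define g where "g x = indicator (cball 0 (\<bar>R\<bar> + norm e)) x * (L * norm e)" for x :: 'a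
  have cs: "continuous_on UNIV (s n)" for n
    unfolding s_def by (intro continuous_intros continuous_on_compose2[OF c]) auto
  have "AE x in lebesgue. (\<lambda>n. s n x) \<longlonglongrightarrow> w x"
    using d
  proof eventually_elim
    case (elim x)
    then have "((\<lambda>t. (F (x + t *\<^sub>R e) - F x) / t) \<longlongrightarrow> w x) (at 0)"
      by (simp add: DERIV_def)
    moreover have "filterlim (\<lambda>n. 1 / real (Suc n)) (at 0) sequentially"
      unfolding filterlim_at using LIMSEQ_inverse_real_of_nat by (simp add: field_simps)
    ultimately show ?case
      unfolding s_def by (rule filterlim_compose)
  qed
  moreover have "norm (s n x) \<le> g x" for n x
  proof (cases "x \<in> cball 0 (\<bar>R\<bar> + norm e)")
    case True
    define h where "h = 1 / real (Suc n)"
    have h: "0 < h" "h \<le> 1" by (auto simp: h_def)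
    have "norm (x + h *\<^sub>R e) \<le> norm x + h * norm e"
      using norm_triangle_ineq[of x "h *\<^sub>R e"] h by simp
    also have "\<dots> \<le> (\<bar>R\<bar> + norm e) + norm e"
      using True h by (intro add_mono mult_left_le_one_le) auto
    finally have "dist (F (x + h *\<^sub>R e)) (F x) \<le> L * dist (x + h *\<^sub>R e) x"
      using True norm_ge_zero[of e] by (intro lipschitz_onD[OF L]) (auto simp del: norm_ge_zero)
    then have "\<bar>F (x + h *\<^sub>R e) - F x\<bar> \<le> L * norm e * h"
      using h by (simp add: dist_norm mult_ac)
    then have "\<bar>(F (x + h *\<^sub>R e) - F x) / h\<bar> \<le> L * norm e"
      using h by (simp add: abs_div_pos[symmetric] pos_divide_le_eq)
    moreover have "s n x = (F (x + h *\<^sub>R e) - F x) / h"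
      unfolding s_def h_def ..
    ultimately show ?thesis using True by (simp add: g_def)
  next
    case False
    define h where "h = 1 / real (Suc n)"
    have h: "0 < h" "h \<le> 1" by (auto simp: h_def)
    have "norm x \<le> norm (x + h *\<^sub>R e) + h * norm e"
      using norm_triangle_sub[of x "x + h *\<^sub>R e"] h by simp
    also have "\<dots> \<le> norm (x + h *\<^sub>R e) + norm e"
      using h by (intro add_mono mult_left_le_one_le) auto
    finally have "F (x + h *\<^sub>R e) = 0"
      using False by (intro z) auto
    moreover have "F x = 0" using False norm_ge_zero[of e]
      by (intro z) (simp add: not_le del: norm_ge_zero)
    moreover have "s n x = (F (x + h *\<^sub>R e) - F x) / h"
      unfolding s_def h_def ..
    ultimately show ?thesis using False by (simp add: g_def)
  qed
  moreover have "integrable lebesgue g"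
  proof -
    have "emeasure lebesgue (cball (0::'a) (\<bar>R\<bar> + norm e)) < \<infinity>"
      using lmeasurable_compact[OF compact_cball] unfolding fmeasurable_def by blast
    then show ?thesis
      unfolding g_def by (intro integrable_mult_left integrable_real_indicator) (auto intro: lmeasurable_compact fmeasurableD)
  qed
  moreover have "s n \<in> borel_measurable lebesgue" for n
    by (intro measurable_completion) (simp add: borel_measurable_continuous_onI[OF cs])
  ultimately have iw: "integrable lebesgue w"
    and lim: "(\<lambda>n. LINT x|lebesgue. s n x) \<longlonglongrightarrow> (LINT x|lebesgue. w x)"
    using w by (auto intro!: integrable_dominated_convergence[of w lebesgue s g]
        integral_dominated_convergence[of w lebesgue s g])
  have "(LINT x|lebesgue. s n x) = 0" for n
    unfolding s_def using translation_difference_integral[OF c z] by simp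
  with lim show "(LINT x|lebesgue. w x) = 0"
    by (simp add: LIMSEQ_const_iff)
  show "integrable lebesgue w" by fact
qed

text \<open>Integration by parts without Fubini: the preceding lemma is applied to the product of \<open>u\<close> with the
  test function, which is locally Lipschitz with compact support.\<close>

lemma weak_partial_of_ae_derivative:
  assumes lip: "lipschitz_on_balls u" and v: "v \<in> borel_measurable borel"
    and d: "AE x in lebesgue. ((\<lambda>t. u (x + t *\<^sub>R axis j 1)) has_real_derivative v x) (at 0)"
  shows "weak_partial_on UNIV j u v"
  unfolding weak_partial_on_def
proof (intro allI impI)
  fix \<phi> assume \<phi>: "test_function_on UNIV \<phi>"
  have lip\<phi>: "lipschitz_on_balls \<phi>" by (rule test_function_lipschitz_on_balls[OF \<phi>])
  have cu: "continuous_on UNIV u" and c\<phi>: "continuous_on UNIV \<phi>"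
    using lip lip\<phi> lipschitz_on_balls_continuous by auto
  have "bounded (closure {x. \<phi> x \<noteq> 0})"
    using \<phi> unfolding test_function_on_def by (simp add: compact_imp_bounded)
  then obtain R where R: "\<And>x. x \<in> closure {x. \<phi> x \<noteq> 0} \<Longrightarrow> norm x \<le> R"
    unfolding bounded_iff by blast
  have z0: "x \<notin> closure {x. \<phi> x \<noteq> 0}" if "norm x > R" for x
    using R[of x] that by force
  have z: "\<phi> x = 0" if "norm x > R" for x
    using z0[OF that] closure_subset[of "{x. \<phi> x \<noteq> 0}"] by blast
  have d\<phi>: "((\<lambda>t. \<phi> (x + t *\<^sub>R axis j 1)) has_real_derivative partial j \<phi> x) (at 0)" for x
  proof -
    have "(\<phi> has_derivative frechet_derivative \<phi> (at x)) (at (x + 0 *\<^sub>R axis j 1))"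
      using test_function_C1(1)[OF \<phi>, of x] by (simp flip: frechet_derivative_works)
    moreover have "((\<lambda>t. x + t *\<^sub>R axis j 1) has_derivative (\<lambda>t. t *\<^sub>R axis j 1)) (at 0)"
      by (auto intro!: derivative_eq_intros)
    ultimately have "((\<lambda>t. \<phi> (x + t *\<^sub>R axis j 1)) has_derivative
        (\<lambda>t. frechet_derivative \<phi> (at x) (t *\<^sub>R axis j 1))) (at 0)"
      by (rule has_derivative_compose[rotated])
    moreover have "frechet_derivative \<phi> (at x) (t *\<^sub>R axis j 1) = partial j \<phi> x * t" for t
      using linear_scale[OF linear_frechet_derivative[OF test_function_C1(1)[OF \<phi>]]]
      by (simp add: partial_def)
    ultimately show ?thesis
      by (simp add: has_field_derivative_def)
  qed
  have zp: "partial j \<phi> x = 0" if "norm x > R" for x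
  proof -
    have "(\<phi> has_derivative frechet_derivative \<phi> (at x)) (at x)"
      using test_function_C1(1)[OF \<phi>] frechet_derivative_works by blast
    then have "((\<lambda>x. 0) has_derivative frechet_derivative \<phi> (at x)) (at x)"
    proof (rule has_derivative_transform_within_open)
      show "open (- closure {x. \<phi> x \<noteq> 0})" by (simp add: open_Compl)
      show "x \<in> - closure {x. \<phi> x \<noteq> 0}" using z0[OF that] by simp
      show "\<phi> y = 0" if "y \<in> - closure {x. \<phi> x \<noteq> 0}" for y
        using that closure_subset[of "{x. \<phi> x \<noteq> 0}"] by blast
    qed
    then have "frechet_derivative \<phi> (at x) = (\<lambda>x. 0)"
      using has_derivative_const has_derivative_unique by blast
    then show ?thesis by (simp add: partial_def)
  qed
  define w where "w x = v x * \<phi> x + u x * partial j \<phi> x" for x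
  have mw: "w \<in> borel_measurable borel"
    unfolding w_def using v borel_measurable_continuous_onI[OF cu] borel_measurable_continuous_onI[OF c\<phi>]
      borel_measurable_continuous_onI[OF test_function_C1(2)[OF \<phi>]] by measurable
  have "AE x in lebesgue. ((\<lambda>t. u (x + t *\<^sub>R axis j 1) * \<phi> (x + t *\<^sub>R axis j 1)) has_real_derivative w x) (at 0)"
    using d
  proof eventually_elim
    case (elim x)
    show ?case unfolding w_def
      using DERIV_mult[OF elim d\<phi>[of x]] by (simp add: algebra_simps)
  qed
  from compact_support_directional_derivative_integral[OF lipschitz_on_balls_mult[OF lip lip\<phi>] _ this, of R]
  have iw: "integrable lebesgue w" "(LINT x|lebesgue. w x) = 0"
    using z mw by (simp_all add: measurable_completion)
  have iu: "integrable lebesgue (\<lambda>x. u x * partial j \<phi> x)"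
    by (rule compact_support_integrable[of _ R])
       (auto intro!: continuous_intros cu test_function_C1(2)[OF \<phi>] simp: zp)
  have "(LINT x|lebesgue. v x * \<phi> x) = (LINT x|lebesgue. w x - u x * partial j \<phi> x)"
    by (simp add: w_def)
  also have "\<dots> = - (LINT x|lebesgue. u x * partial j \<phi> x)"
    using iw iu by simp
  finally show "(LINT x:UNIV|lebesgue. u x * partial j \<phi> x) = - (LINT x:UNIV|lebesgue. v x * \<phi> x)"
    by (simp add: set_lebesgue_integral_def)
qed

lemma L2_loc_of_continuous_bound:
  assumes u: "u \<in> borel_measurable borel" and M: "continuous_on UNIV M" and le: "\<And>x. \<bar>u x\<bar> \<le> M x"
  shows "L2_loc UNIV u"
  unfolding L2_loc_def
proof (intro conjI allI impI)
  show "set_borel_measurable lebesgue UNIV u"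
    using u by (simp add: set_borel_measurable_def measurable_completion)
  fix C :: "(real^2) set" assume C: "compact C \<and> C \<subseteq> UNIV"
  have "integrable lborel (\<lambda>x. indicator C x *\<^sub>R (M x)\<^sup>2)"
    using C M by (intro borel_integrable_compact continuous_intros) (auto intro: continuous_on_subset)
  moreover have mC: "C \<in> sets borel" using C by (simp add: borel_compact)
  moreover have m: "(\<lambda>x. indicator C x *\<^sub>R (u x)\<^sup>2) \<in> borel_measurable borel"
    using u mC by measurable
  ultimately have "integrable lborel (\<lambda>x. indicator C x *\<^sub>R (u x)\<^sup>2)"
  proof (rule_tac Bochner_Integration.integrable_bound)
    show "AE x in lborel. norm (indicator C x *\<^sub>R (u x)\<^sup>2) \<le> norm (indicator C x *\<^sub>R (M x)\<^sup>2)"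
    proof (rule AE_I2)
      fix x
      have "(u x)\<^sup>2 \<le> (M x)\<^sup>2" using le[of x] by (simp add: abs_le_square_iff[symmetric])
      then show "norm (indicator C x *\<^sub>R (u x)\<^sup>2) \<le> norm (indicator C x *\<^sub>R (M x)\<^sup>2)"
        by (simp add: indicator_def)
    qed
  qed auto
  then show "set_integrable lebesgue C (\<lambda>x. (u x)\<^sup>2)"
    using m by (simp add: set_integrable_def integrable_completion)
qed

section \<open>The saddle map\<close>

definition shrink :: real where "shrink = exp (- (2 * pi))"

text \<open>The half-height of the chain of lenses along the positive horizontal axis. The chain is
  invariant under the homothety with factor \<open>shrink\<close> because \<open>ln\<close> turns this homothety into a translation by
  the period of \<open>cos\<close>; the lenses are pinched off from each other at the zeros \<open>shrink ^ k\<close>.\<close>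

definition height :: "real \<Rightarrow> real" where
  "height a = (if a > 0 then a * (1 - cos (ln a)) else 0)"

definition height_deriv :: "real \<Rightarrow> real" where
  "height_deriv a = (if a > 0 then 1 - cos (ln a) + sin (ln a) else 0)"

text \<open>The correction that turns the slope \<open>shrink\<close> of the linear contraction into that of \<open>4 * t + sin t\<close> as soon
  as a point lies above the chain of lenses. The value of \<open>push_deriv\<close> at the kink is the left derivative; with
  this choice the dilatation bound below holds at every point.\<close>

definition push :: "real \<Rightarrow> real" where
  "push t = (if t > 0 then (4 - shrink) * t + sin t else 0)"

definition push_deriv :: "real \<Rightarrow> real" where
  "push_deriv t = (if t > 0 then 4 - shrink + cos t else 0)"

text \<open>On the closed left half-plane this is the entire function \<open>z \<mapsto> 4 * z + sinh z\<close>, whose restriction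
  to the imaginary axis is \<open>\<i> * t \<mapsto> \<i> * (4 * t + sin t)\<close>. That restriction is a bi-Lipschitz homeomorphism of
  the axis, so it can be continued to the right by a quasiconformal map which contracts horizontally and
  expands the vertical distance from the chain of lenses.\<close>

definition saddle :: "real^2 \<Rightarrow> real^2" where
  "saddle p = (let a = p $ 1; b = p $ 2 in
     if a \<le> 0 then vector [4 * a + sinh a * cos b, 4 * b + cosh a * sin b]
     else vector [shrink * a, shrink * b + push (b - height a) - push (- b - height a)])"

definition saddle_deriv :: "real^2 \<Rightarrow> real^2^2" where
  "saddle_deriv p = (let a = p $ 1; b = p $ 2 in
     if a \<le> 0 then vector [vector [4 + cosh a * cos b, - (sinh a * sin b)],
                            vector [sinh a * sin b, 4 + cosh a * cos b]]
     else vector [vector [shrink, 0],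
       vector [height_deriv a * (push_deriv (- b - height a) - push_deriv (b - height a)),
               shrink + push_deriv (b - height a) + push_deriv (- b - height a)]])"

lemma shrink_pos: "0 < shrink" and shrink_less_1: "shrink < 1"
  by (simp_all add: shrink_def)

lemma height_nonneg: "height a \<ge> 0"
  by (simp add: height_def)

lemma height_le: "a \<ge> 0 \<Longrightarrow> height a \<le> 2 * a"
  using mult_left_mono[OF cos_ge_minus_one[of "ln a"], of a] by (simp add: height_def algebra_simps)

lemma height_shrink: "height (shrink * a) = shrink * height a"
proof (cases "a > 0")
  case True
  have "ln (shrink * a) = ln a - 2 * pi"
    using True by (subst ln_mult) (auto simp: shrink_def)
  then have "cos (ln (shrink * a)) = cos (ln a)"
    by (simp add: cos_diff)
  with True show ?thesis
    using shrink_pos by (simp add: height_def)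
next
  case False
  then show ?thesis
    using shrink_pos by (simp add: height_def zero_less_mult_iff)
qed

lemma height_has_derivative:
  assumes "a \<noteq> 0"
  shows "(height has_real_derivative height_deriv a) (at a)"
proof (cases "a > 0")
  case True
  have "((\<lambda>a. a * (1 - cos (ln a))) has_real_derivative height_deriv a) (at a)"
    using True by (auto intro!: derivative_eq_intros simp: height_deriv_def)
  then show ?thesis
    by (rule has_field_derivative_transform_within_open[where S = "{0<..}"])
       (use True in \<open>auto simp: height_def\<close>)
next
  case False
  with assms have "a < 0" by simp
  have "((\<lambda>_. 0) has_real_derivative height_deriv a) (at a)"
    using \<open>a < 0\<close> by (simp add: height_deriv_def)
  then show ?thesis
    by (rule has_field_derivative_transform_within_open[where S = "{..<0}"])
       (use \<open>a < 0\<close> in \<open>auto simp: height_def\<close>)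
qed

lemma abs_height_deriv: "\<bar>height_deriv a\<bar> \<le> 3"
  using cos_ge_minus_one[of "ln a"] cos_le_one[of "ln a"] sin_ge_minus_one[of "ln a"] sin_le_one[of "ln a"]
  unfolding height_deriv_def abs_le_iff by (simp del: cos_le_one cos_ge_minus_one sin_le_one sin_ge_minus_one)

lemma height_lipschitz: "\<bar>height x - height y\<bar> \<le> 3 * \<bar>x - y\<bar>"
proof -
  have *: "\<bar>height x - height y\<bar> \<le> 3 * \<bar>x - y\<bar>" if "x < y" for x y
  proof (cases "x > 0")
    case True
    have "norm (height x - height y) \<le> 3 * norm (x - y)"
      by (rule field_differentiable_bound[of "{0<..}" height height_deriv])
         (use True that in \<open>auto intro: has_field_derivative_at_within height_has_derivative abs_height_deriv\<close>)
    then show ?thesis by simp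
  next
    case False
    then have "height x = 0" by (simp add: height_def)
    moreover have "height y \<le> 3 * (y - x)"
    proof (cases "y > 0")
      case True
      with height_le[of y] False show ?thesis by simp
    qed (use that in \<open>simp add: height_def\<close>)
    ultimately show ?thesis
      using height_nonneg[of y] that by (simp add: abs_if)
  qed
  show ?thesis
    using *[of x y] *[of y x] by (cases x y rule: linorder_cases) (auto simp: abs_minus_commute)
qed

lemma push_has_derivative:
  assumes "t \<noteq> 0"
  shows "(push has_real_derivative push_deriv t) (at t)"
proof (cases "t > 0")
  case True
  have "((\<lambda>t. (4 - shrink) * t + sin t) has_real_derivative push_deriv t) (at t)"
    using True by (auto intro!: derivative_eq_intros simp: push_deriv_def)
  then show ?thesis
    by (rule has_field_derivative_transform_within_open[where S = "{0<..}"])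
       (use True in \<open>auto simp: push_def\<close>)
next
  case False
  with assms have "t < 0" by simp
  have "((\<lambda>_. 0) has_real_derivative push_deriv t) (at t)"
    using \<open>t < 0\<close> by (simp add: push_deriv_def)
  then show ?thesis
    by (rule has_field_derivative_transform_within_open[where S = "{..<0}"])
       (use \<open>t < 0\<close> in \<open>auto simp: push_def\<close>)
qed

lemma push_deriv_bounds:
  "push_deriv t \<ge> 0" "push_deriv t \<le> 5" "t > 0 \<Longrightarrow> push_deriv t \<ge> 3 - shrink"
  "shrink + push_deriv t \<le> 5"
  using cos_ge_minus_one[of t] cos_le_one[of t] shrink_pos shrink_less_1
  unfolding push_deriv_def by (simp_all del: cos_le_one cos_ge_minus_one)

lemma push_deriv_nonpos: "t \<le> 0 \<Longrightarrow> push_deriv t = 0"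
  by (simp add: push_deriv_def)

lemma push_ge: "t \<ge> 0 \<Longrightarrow> push t \<ge> (3 - shrink) * t"
proof -
  assume "t \<ge> 0"
  then have "sin t \<ge> - t" using abs_sin_x_le_abs_x[of t] by simp
  with \<open>t \<ge> 0\<close> show ?thesis by (auto simp: push_def algebra_simps)
qed

lemma push_nonpos: "t \<le> 0 \<Longrightarrow> push t = 0"
  by (simp add: push_def)

lemma lipschitz_on_balls_nth: "lipschitz_on_balls (\<lambda>p :: real^'n. p $ i)"
  by (rule lipschitz_imp_on_balls[of _ 1])
     (use component_le_norm_cart[of "x - y" i for x y :: "real^'n"] in auto)

lemma lipschitz_on_balls_smooth:
  "lipschitz_on_balls (sin :: real \<Rightarrow> real)" "lipschitz_on_balls (cos :: real \<Rightarrow> real)"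
  "lipschitz_on_balls (sinh :: real \<Rightarrow> real)" "lipschitz_on_balls (cosh :: real \<Rightarrow> real)"
proof -
  show "lipschitz_on_balls (sin :: real \<Rightarrow> real)"
    by (rule C1_real_lipschitz_on_balls[OF DERIV_sin]) (intro continuous_intros)
  show "lipschitz_on_balls (cos :: real \<Rightarrow> real)"
    by (rule C1_real_lipschitz_on_balls[OF DERIV_cos]) (intro continuous_intros)
  show "lipschitz_on_balls (sinh :: real \<Rightarrow> real)"
    by (rule C1_real_lipschitz_on_balls[where g' = cosh]) (auto intro!: derivative_eq_intros continuous_intros)
  show "lipschitz_on_balls (cosh :: real \<Rightarrow> real)"
    by (rule C1_real_lipschitz_on_balls[where g' = sinh]) (auto intro!: derivative_eq_intros continuous_intros)
qed

lemma lipschitz_on_balls_min_max: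
  "lipschitz_on_balls (\<lambda>t::real. min t 0)" "lipschitz_on_balls (\<lambda>t::real. max t 0)"
  by (rule lipschitz_imp_on_balls[of _ 1]; auto simp: min_def max_def abs_if)+

lemma lipschitz_on_balls_height: "lipschitz_on_balls height"
  by (rule lipschitz_imp_on_balls[of _ 3]) (auto simp: height_lipschitz)

lemma lipschitz_on_balls_push: "lipschitz_on_balls push"
proof -
  have "push = (\<lambda>t. (4 - shrink) * max t 0 + sin (max t 0))"
    by (auto simp: fun_eq_iff push_def max_def)
  moreover have "lipschitz_on_balls (\<lambda>t. (4 - shrink) * max t 0 + sin (max t 0))"
    by (intro lipschitz_on_balls_add lipschitz_on_balls_cmult lipschitz_on_balls_min_max
        lipschitz_on_balls_compose[OF lipschitz_on_balls_smooth(1)])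
  ultimately show ?thesis by metis
qed

text \<open>A formula without case distinction on the side of the axis, from which continuity and local
  Lipschitz bounds across the axis can be read off.\<close>

lemma saddle_nth:
  "saddle p $ 1 = 4 * min (p $ 1) 0 + sinh (min (p $ 1) 0) * cos (p $ 2) + shrink * max (p $ 1) 0"
  "saddle p $ 2 = shrink * p $ 2 + push (p $ 2 - height (p $ 1)) - push (- p $ 2 - height (p $ 1))
     + (cosh (min (p $ 1) 0) - 1) * sin (p $ 2)"
  by (auto simp: saddle_def Let_def vector_2 height_def push_def algebra_simps sin_minus)

lemma saddle_lipschitz_on_balls: "lipschitz_on_balls (\<lambda>p. saddle p $ i)"
proof -
  note nth = lipschitz_on_balls_nth[where 'n = 2]
  note c = lipschitz_on_balls_compose
  have "lipschitz_on_balls (\<lambda>p. saddle p $ 1)"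
    unfolding saddle_nth
    by (intro lipschitz_on_balls_add lipschitz_on_balls_cmult lipschitz_on_balls_mult
        c[OF lipschitz_on_balls_smooth(2)] c[OF lipschitz_on_balls_smooth(3)]
        c[OF lipschitz_on_balls_min_max(1)] c[OF lipschitz_on_balls_min_max(2)] nth)
  moreover have "lipschitz_on_balls (\<lambda>p. saddle p $ 2)"
    unfolding saddle_nth
    by (intro lipschitz_on_balls_add lipschitz_on_balls_diff lipschitz_on_balls_cmult lipschitz_on_balls_mult
        lipschitz_on_balls_const lipschitz_on_balls_minus
        c[OF lipschitz_on_balls_smooth(1)] c[OF lipschitz_on_balls_smooth(4)]
        c[OF lipschitz_on_balls_push] c[OF lipschitz_on_balls_height]
        c[OF lipschitz_on_balls_min_max(1)] nth)
  ultimately show ?thesis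
    using exhaust_2[of i] by auto
qed

lemma continuous_saddle: "continuous_on UNIV saddle"
proof -
  have "continuous_on UNIV (\<lambda>p. \<chi> i. saddle p $ i)"
    by (intro continuous_on_vec_lambda lipschitz_on_balls_continuous saddle_lipschitz_on_balls)
  then show ?thesis by simp
qed

lemma negligible_lipschitz_graph:
  fixes g :: "real \<Rightarrow> real"
  assumes "\<And>x y. \<bar>g x - g y\<bar> \<le> L * \<bar>x - y\<bar>"
  shows "negligible {p :: real^2. p $ 2 = g (p $ 1)}"
proof -
  define G where "G p = (vector [p $ 1, g (p $ 1)] :: real^2)" for p :: "real^2"
  have L: "L \<ge> 0" using order_trans[OF abs_ge_zero assms[of 1 0]] by simp
  have "negligible (G ` {p. p $ 2 = 0})"
  proof (rule negligible_locally_Lipschitz_image)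
    fix x :: "real^2"
    have "norm (G y - G x) \<le> (1 + L) * norm (y - x)" for y
    proof -
      have "norm (G y - G x) \<le> \<bar>(G y - G x) $ 1\<bar> + \<bar>(G y - G x) $ 2\<bar>"
        using norm_le_l1_cart[of "G y - G x"] by (simp add: sum_2)
      also have "\<dots> \<le> \<bar>(y - x) $ 1\<bar> + L * \<bar>(y - x) $ 1\<bar>"
        using assms[of "y $ 1" "x $ 1"] by (simp add: G_def vector_2)
      also have "\<dots> \<le> (1 + L) * norm (y - x)"
        using component_le_norm_cart[of "y - x" 1] L
        by (metis distrib_right mult_left_mono mult_1 add_mono)
      finally show ?thesis .
    qed
    then show "\<exists>T B. open T \<and> x \<in> T \<and> (\<forall>y\<in>{p. p $ 2 = 0} \<inter> T. norm (G y - G x) \<le> B * norm (y - x))"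
      by (intro exI[of _ UNIV] exI[of _ "1 + L"]) auto
  qed (auto intro: negligible_standard_hyperplane_cart)
  moreover have "{p :: real^2. p $ 2 = g (p $ 1)} \<subseteq> G ` {p. p $ 2 = 0}"
  proof
    fix p :: "real^2" assume p: "p \<in> {p. p $ 2 = g (p $ 1)}"
    have "G (vector [p $ 1, 0]) = p"
      using p by (simp add: G_def vec_eq_iff forall_2 vector_2)
    then show "p \<in> G ` {p. p $ 2 = 0}"
      by (metis (mono_tags, lifting) imageI mem_Collect_eq vector_2(2))
  qed
  ultimately show ?thesis
    using negligible_subset by blast
qed

lemma saddle_deriv_nth:
  "saddle_deriv p $ 1 $ 1 = (if p $ 1 \<le> 0 then 4 + cosh (p $ 1) * cos (p $ 2) else shrink)"
  "saddle_deriv p $ 1 $ 2 = (if p $ 1 \<le> 0 then - (sinh (p $ 1) * sin (p $ 2)) else 0)"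
  "saddle_deriv p $ 2 $ 1 = (if p $ 1 \<le> 0 then sinh (p $ 1) * sin (p $ 2) else
     height_deriv (p $ 1) * (push_deriv (- p $ 2 - height (p $ 1)) - push_deriv (p $ 2 - height (p $ 1))))"
  "saddle_deriv p $ 2 $ 2 = (if p $ 1 \<le> 0 then 4 + cosh (p $ 1) * cos (p $ 2) else
     shrink + push_deriv (p $ 2 - height (p $ 1)) + push_deriv (- p $ 2 - height (p $ 1)))"
  by (simp_all add: saddle_deriv_def Let_def vector_2)

lemma saddle_deriv_abs: "\<bar>saddle_deriv p $ i $ j\<bar> \<le> 15 + cosh (p $ 1)"
proof -
  have c: "\<bar>cosh (p $ 1) * cos (p $ 2)\<bar> \<le> cosh (p $ 1)"
    by (simp add: abs_mult mult_left_le)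
  have s0: "\<bar>sinh (p $ 1)\<bar> \<le> cosh (p $ 1)"
    using sinh_less_cosh_real[of "\<bar>p $ 1\<bar>"] by (simp add: abs_if split: if_splits)
  have "\<bar>sinh (p $ 1) * sin (p $ 2)\<bar> \<le> \<bar>sinh (p $ 1)\<bar>"
    by (simp add: abs_mult mult_left_le)
  with s0 have s: "\<bar>sinh (p $ 1) * sin (p $ 2)\<bar> \<le> cosh (p $ 1)" by linarith
  have "\<bar>height_deriv (p $ 1) * (push_deriv (- p $ 2 - height (p $ 1)) - push_deriv (p $ 2 - height (p $ 1)))\<bar> \<le> 3 * 5"
    unfolding abs_mult
  proof (intro mult_mono abs_height_deriv)
    show "\<bar>push_deriv (- p $ 2 - height (p $ 1)) - push_deriv (p $ 2 - height (p $ 1))\<bar> \<le> 5"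
      using push_deriv_bounds(1,2)[of "p $ 2 - height (p $ 1)"]
        push_deriv_bounds(1,2)[of "- p $ 2 - height (p $ 1)"] by linarith
  qed auto
  then have e21: "\<bar>saddle_deriv p $ 2 $ 1\<bar> \<le> 15 + cosh (p $ 1)"
    unfolding saddle_deriv_nth using s cosh_real_ge_1[of "p $ 1"] by (simp split: if_split)
  have e11: "\<bar>saddle_deriv p $ 1 $ 1\<bar> \<le> 15 + cosh (p $ 1)"
    unfolding saddle_deriv_nth using c shrink_pos shrink_less_1 cosh_real_ge_1[of "p $ 1"]
    by (cases "p $ 1 \<le> 0"; simp only: if_True if_False; linarith)
  have e12: "\<bar>saddle_deriv p $ 1 $ 2\<bar> \<le> 15 + cosh (p $ 1)"
    unfolding saddle_deriv_nth using s cosh_real_ge_1[of "p $ 1"]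
    by (cases "p $ 1 \<le> 0"; simp only: if_True if_False; linarith)
  have e22: "\<bar>saddle_deriv p $ 2 $ 2\<bar> \<le> 15 + cosh (p $ 1)"
    unfolding saddle_deriv_nth using c push_deriv_bounds(1,2)[of "p $ 2 - height (p $ 1)"]
      push_deriv_bounds(1,2)[of "- p $ 2 - height (p $ 1)"] shrink_pos shrink_less_1 cosh_real_ge_1[of "p $ 1"]
    by (cases "p $ 1 \<le> 0"; simp only: if_True if_False; linarith)
  show ?thesis
    using exhaust_2[of i] exhaust_2[of j] e11 e12 e21 e22 by auto
qed

lemma saddle_deriv_measurable: "(\<lambda>p. saddle_deriv p $ i $ j) \<in> borel_measurable borel"
proof -
  have [measurable]: "(\<lambda>p :: real^2. p $ k) \<in> borel_measurable borel" for k
    by (intro borel_measurable_continuous_onI continuous_intros)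
  have [measurable]: "height \<in> borel_measurable borel"
    by (intro borel_measurable_continuous_onI lipschitz_on_balls_continuous lipschitz_on_balls_height)
  have [measurable]: "cosh \<in> borel_measurable (borel :: real measure)" "sinh \<in> borel_measurable (borel :: real measure)"
    by (intro borel_measurable_continuous_onI continuous_intros)+
  have [measurable]: "height_deriv \<in> borel_measurable borel" "push_deriv \<in> borel_measurable borel"
    unfolding height_deriv_def push_deriv_def by measurable
  have "(\<lambda>p. saddle_deriv p $ 1 $ 1) \<in> borel_measurable borel" "(\<lambda>p. saddle_deriv p $ 1 $ 2) \<in> borel_measurable borel"
    "(\<lambda>p. saddle_deriv p $ 2 $ 1) \<in> borel_measurable borel" "(\<lambda>p. saddle_deriv p $ 2 $ 2) \<in> borel_measurable borel"
    unfolding saddle_deriv_nth by measurable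
  then show ?thesis
    using exhaust_2[of i] exhaust_2[of j] by metis
qed

section \<open>Quasiregularity\<close>

lemma saddle_directional_derivative:
  assumes a: "p $ 1 \<noteq> 0" and b: "p $ 2 \<noteq> height (p $ 1)" "p $ 2 \<noteq> - height (p $ 1)"
  shows "((\<lambda>t. saddle (p + t *\<^sub>R axis j 1) $ i) has_real_derivative saddle_deriv p $ i $ j) (at 0)"
proof (cases "p $ 1 < 0")
  case True
  define S where "S = {..< - p $ 1}"
  have S: "open S" "0 \<in> S" using True by (auto simp: S_def)
  have *: "((\<lambda>t. 4 * (p $ 1 + t) + sinh (p $ 1 + t) * cos (p $ 2)) has_real_derivative saddle_deriv p $ 1 $ 1) (at 0)"
    "((\<lambda>t. 4 * p $ 1 + sinh (p $ 1) * cos (p $ 2 + t)) has_real_derivative saddle_deriv p $ 1 $ 2) (at 0)"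
    "((\<lambda>t. 4 * p $ 2 + cosh (p $ 1 + t) * sin (p $ 2)) has_real_derivative saddle_deriv p $ 2 $ 1) (at 0)"
    "((\<lambda>t. 4 * (p $ 2 + t) + cosh (p $ 1) * sin (p $ 2 + t)) has_real_derivative saddle_deriv p $ 2 $ 2) (at 0)"
    using True by (auto intro!: derivative_eq_intros simp: saddle_deriv_nth)
  show ?thesis
    using exhaust_2[of i] exhaust_2[of j]
    by (elim disjE; simp only:; intro has_field_derivative_transform_within_open[OF *(1) S]
        has_field_derivative_transform_within_open[OF *(2) S]
        has_field_derivative_transform_within_open[OF *(3) S]
        has_field_derivative_transform_within_open[OF *(4) S])
       (use True in \<open>auto simp: saddle_def Let_def vector_2 axis_def S_def\<close>)
next
  case False
  with a have pos: "p $ 1 > 0" by simp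
  define S where "S = {- p $ 1 <..}"
  have S: "open S" "0 \<in> S" using pos by (auto simp: S_def)
  have h: "((\<lambda>t. height (p $ 1 + t)) has_real_derivative height_deriv (p $ 1)) (at 0)"
  proof -
    have "((\<lambda>t. p $ 1 + t) has_real_derivative 1) (at 0)"
      by (auto intro!: derivative_eq_intros)
    from DERIV_chain2[OF _ this, of height "height_deriv (p $ 1)"] height_has_derivative[OF a]
    show ?thesis by simp
  qed
  have pu: "((\<lambda>t. push (g t)) has_real_derivative push_deriv (g 0) * g') (at 0)"
    if "(g has_real_derivative g') (at 0)" "g 0 \<noteq> 0" for g g'
    using DERIV_chain2[OF push_has_derivative[OF that(2)] that(1)] .
  have v: "((\<lambda>t. p $ 2 - height (p $ 1 + t)) has_real_derivative 0 - height_deriv (p $ 1)) (at 0)"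
      "((\<lambda>t. - p $ 2 - height (p $ 1 + t)) has_real_derivative 0 - height_deriv (p $ 1)) (at 0)"
      "((\<lambda>t. p $ 2 + t - height (p $ 1)) has_real_derivative 1) (at 0)"
      "((\<lambda>t. - (p $ 2 + t) - height (p $ 1)) has_real_derivative -1) (at 0)"
    using DERIV_diff[OF DERIV_const h] by (auto intro!: derivative_eq_intros)
  have u: "((\<lambda>t. push (p $ 2 - height (p $ 1 + t))) has_real_derivative
        push_deriv (p $ 2 - height (p $ 1)) * (0 - height_deriv (p $ 1))) (at 0)"
      "((\<lambda>t. push (- p $ 2 - height (p $ 1 + t))) has_real_derivative
        push_deriv (- p $ 2 - height (p $ 1)) * (0 - height_deriv (p $ 1))) (at 0)"
      "((\<lambda>t. push (p $ 2 + t - height (p $ 1))) has_real_derivative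
        push_deriv (p $ 2 - height (p $ 1)) * 1) (at 0)"
      "((\<lambda>t. push (- (p $ 2 + t) - height (p $ 1))) has_real_derivative
        push_deriv (- p $ 2 - height (p $ 1)) * (-1)) (at 0)"
    using pu[OF v(1)] pu[OF v(2)] pu[OF v(3)] pu[OF v(4)] b by simp_all
  have *: "((\<lambda>t. shrink * (p $ 1 + t)) has_real_derivative saddle_deriv p $ 1 $ 1) (at 0)"
    "((\<lambda>t. shrink * p $ 1) has_real_derivative saddle_deriv p $ 1 $ 2) (at 0)"
    "((\<lambda>t. shrink * p $ 2 + push (p $ 2 - height (p $ 1 + t)) - push (- p $ 2 - height (p $ 1 + t)))
      has_real_derivative saddle_deriv p $ 2 $ 1) (at 0)"
    "((\<lambda>t. shrink * (p $ 2 + t) + push (p $ 2 + t - height (p $ 1)) - push (- (p $ 2 + t) - height (p $ 1)))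
      has_real_derivative saddle_deriv p $ 2 $ 2) (at 0)"
       apply (use pos in \<open>(auto intro!: derivative_eq_intros simp: saddle_deriv_nth)[2]\<close>)
     apply (rule DERIV_cong[OF DERIV_diff[OF DERIV_add[OF DERIV_const u(1)] u(2)]])
     apply (use pos in \<open>simp add: saddle_deriv_nth algebra_simps\<close>)
    apply (rule DERIV_cong[OF DERIV_diff[OF DERIV_add[OF DERIV_cmult[OF DERIV_add[OF DERIV_const DERIV_ident]] u(3)] u(4)]])
    apply (use pos in \<open>simp add: saddle_deriv_nth algebra_simps\<close>)
    done
  show ?thesis
    using exhaust_2[of i] exhaust_2[of j]
    by (elim disjE; simp only:; intro has_field_derivative_transform_within_open[OF *(1) S]
        has_field_derivative_transform_within_open[OF *(2) S]
        has_field_derivative_transform_within_open[OF *(3) S]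
        has_field_derivative_transform_within_open[OF *(4) S])
       (use pos in \<open>auto simp: saddle_def Let_def vector_2 axis_def S_def\<close>)
qed

lemma saddle_ae_derivative:
  "AE p in lebesgue. ((\<lambda>t. saddle (p + t *\<^sub>R axis j 1) $ i) has_real_derivative saddle_deriv p $ i $ j) (at 0)"
proof -
  define N where "N = {p :: real^2. p $ 1 = 0} \<union> {p. p $ 2 = height (p $ 1)} \<union> {p. p $ 2 = - height (p $ 1)}"
  have "negligible N"
    unfolding N_def
    by (intro negligible_Un negligible_standard_hyperplane_cart negligible_lipschitz_graph[of _ 3])
       (use height_lipschitz in \<open>auto simp: abs_minus_commute\<close>)
  then have "N \<in> null_sets lebesgue" by (simp add: negligible_iff_null_sets)
  then have "AE p in lebesgue. p \<notin> N" by (rule AE_not_in)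
  then show ?thesis
    by eventually_elim (rule saddle_directional_derivative, auto simp: N_def)
qed

lemma saddle_dilatation: "(onorm ((*v) (saddle_deriv p)))\<^sup>2 \<le> (441 / shrink) * det (saddle_deriv p)"
proof -
  define A where "A = saddle_deriv p"
  define T where "T = \<bar>A $ 1 $ 1\<bar> + \<bar>A $ 1 $ 2\<bar> + (\<bar>A $ 2 $ 1\<bar> + \<bar>A $ 2 $ 2\<bar>)"
  have "onorm ((*v) A) \<le> T"
    using onorm_le_matrix_component_sum[of A] by (simp add: sum_2 T_def)
  moreover have "0 \<le> onorm ((*v) A)"
    by (rule onorm_pos_le) (rule matrix_vector_mul_bounded_linear)
  ultimately have "(onorm ((*v) A))\<^sup>2 \<le> T\<^sup>2" by (rule power_mono)
  also have "T\<^sup>2 \<le> (441 / shrink) * det A"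
  proof (cases "p $ 1 \<le> 0")
    case True
    define x where "x = 4 + cosh (p $ 1) * cos (p $ 2)"
    define y where "y = sinh (p $ 1) * sin (p $ 2)"
    have A: "A $ 1 $ 1 = x" "A $ 2 $ 2 = x" "A $ 1 $ 2 = - y" "A $ 2 $ 1 = y"
      using True by (simp_all add: A_def saddle_deriv_nth x_def y_def)
    have det: "det A = x\<^sup>2 + y\<^sup>2" by (simp add: det_2 A power2_eq_square)
    have "0 \<le> (\<bar>x\<bar> - \<bar>y\<bar>)\<^sup>2" by simp
    then have "T\<^sup>2 \<le> 8 * (x\<^sup>2 + y\<^sup>2)"
      by (simp add: T_def A power2_eq_square algebra_simps)
    also have "\<dots> \<le> (441 / shrink) * (x\<^sup>2 + y\<^sup>2)"
      using shrink_pos shrink_less_1 by (intro mult_right_mono) (auto simp: field_simps)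
    finally show ?thesis unfolding det .
  next
    case False
    define s where "s = push_deriv (p $ 2 - height (p $ 1))"
    define t where "t = push_deriv (- p $ 2 - height (p $ 1))"
    define k where "k = height_deriv (p $ 1)"
    have A: "A $ 1 $ 1 = shrink" "A $ 1 $ 2 = 0" "A $ 2 $ 1 = k * (t - s)" "A $ 2 $ 2 = shrink + s + t"
      using False by (simp_all add: A_def saddle_deriv_nth s_def t_def k_def)
    have k: "\<bar>k\<bar> \<le> 3" unfolding k_def by (rule abs_height_deriv)
    have st: "s \<ge> 0" "t \<ge> 0" "shrink + s \<le> 5" "shrink + t \<le> 5"
      by (auto simp: s_def t_def push_deriv_bounds)
    have det: "det A = shrink * (shrink + s + t)" by (simp add: det_2 A)
    have T: "T = shrink + \<bar>k\<bar> * \<bar>t - s\<bar> + (shrink + s + t)"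
      using st shrink_pos by (simp add: T_def A abs_mult)
    \<comment> \<open>A point cannot lie both above and below the chain, so at most one correction is active.\<close>
    have zero: "s = 0 \<or> t = 0"
      using height_nonneg[of "p $ 1"] by (auto simp: s_def t_def push_deriv_def)
    consider "s = 0" "t = 0" | "s + t \<ge> 3 - shrink"
    proof -
      have "s = 0 \<or> s \<ge> 3 - shrink" "t = 0 \<or> t \<ge> 3 - shrink"
        unfolding s_def t_def by (metis not_le push_deriv_bounds(3) push_deriv_nonpos)+
      then show thesis using that st by force
    qed
    then show ?thesis
    proof cases
      case 1
      then show ?thesis
        using shrink_pos shrink_less_1 by (simp add: T det power2_eq_square)
    next
      case 2
      have "\<bar>t - s\<bar> \<le> 5" using zero st shrink_pos by auto
      then have "\<bar>k\<bar> * \<bar>t - s\<bar> \<le> 3 * 5" using k by (intro mult_mono) auto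
      then have "T \<le> 21" using zero st shrink_less_1 unfolding T by auto
      then have "T\<^sup>2 \<le> 21\<^sup>2" by (intro power_mono) (simp_all add: T_def)
      also have "\<dots> \<le> 441 * (shrink + s + t)" using 2 by simp
      also have "\<dots> = (441 / shrink) * det A" using shrink_pos by (simp add: det)
      finally show ?thesis .
    qed
  qed
  finally show ?thesis unfolding A_def .
qed

theorem saddle_quasiregular: "quasiregular_on UNIV saddle"
  unfolding quasiregular_on_def
proof (intro exI[of _ "441 / shrink"] conjI)
  show "1 \<le> 441 / shrink"
    using shrink_pos shrink_less_1 by (simp add: field_simps)
  have "formal_derivative_on UNIV saddle saddle_deriv"
    unfolding formal_derivative_on_def
  proof (intro conjI allI)
    fix i j :: 2
    have c: "continuous_on UNIV (\<lambda>p. saddle p $ i)"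
      by (rule lipschitz_on_balls_continuous[OF saddle_lipschitz_on_balls])
    show "L2_loc UNIV (\<lambda>p. saddle p $ i)"
      by (rule L2_loc_of_continuous_bound[where M = "\<lambda>p. \<bar>saddle p $ i\<bar>"])
         (auto intro!: borel_measurable_continuous_onI continuous_intros c)
    show "L2_loc UNIV (\<lambda>p. saddle_deriv p $ i $ j)"
      by (rule L2_loc_of_continuous_bound[OF saddle_deriv_measurable _ saddle_deriv_abs])
         (intro continuous_intros)
    show "weak_partial_on UNIV j (\<lambda>p. saddle p $ i) (\<lambda>p. saddle_deriv p $ i $ j)"
      by (rule weak_partial_of_ae_derivative[OF saddle_lipschitz_on_balls saddle_deriv_measurable saddle_ae_derivative])
  qed
  then show "K_quasiregular_on (441 / shrink) UNIV saddle"
    unfolding K_quasiregular_on_def is_domain_def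
    using continuous_saddle saddle_dilatation by auto
qed

section \<open>The singularity at infinity\<close>

lemma saddle_axis: "p $ 1 = 0 \<Longrightarrow> saddle p = vector [0, 4 * p $ 2 + sin (p $ 2)]"
  by (simp add: saddle_def Let_def)

text \<open>Zeros of \<open>4 * z + sinh z\<close> in the left half-plane. Writing \<open>z = - s + \<i> * y\<close>, the real part vanishes
  for \<open>cos y = - 4 * s / sinh s\<close>. On the branch \<open>y s\<close> of this equation with \<open>sin y \<le> 0\<close> the imaginary part
  changes sign as \<open>s\<close> grows, since \<open>y s\<close> stays between two fixed bounds while \<open>cosh s\<close> is unbounded.
  The number \<open>m\<close> of the branch places the zero arbitrarily far out.\<close>

lemma saddle_zero_far_out: "\<exists>p. norm p \<ge> real n \<and> saddle p = 0"
proof -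
  have "eventually (\<lambda>s::real. sinh s \<ge> 8 * s) at_top"
    by real_asymp
  then obtain r where r: "\<And>s::real. s \<ge> r \<Longrightarrow> sinh s \<ge> 8 * s"
    unfolding eventually_at_top_linorder by blast
  define s1 where "s1 = max r 1"
  have half: "0 \<le> 4 * s / sinh s" "4 * s / sinh s \<le> 1 / 2" "sinh s > 0" if "s \<ge> s1" for s
    using r[of s] that by (auto simp: s1_def field_simps)
  obtain m :: nat where m: "2 * pi * m \<ge> cosh s1" "m \<ge> n"
  proof -
    obtain m0 :: nat where "cosh s1 \<le> m0" using real_arch_simple by blast
    moreover have "real k \<le> 2 * pi * real k" for k
      using pi_gt3 mult_right_mono[of 1 "2 * pi" "real k"] by simp
    ultimately have "cosh s1 \<le> 2 * pi * real (max m0 n)"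
      by (meson max.cobounded1 of_nat_le_iff order_trans)
    then show thesis using that by auto
  qed
  define y where "y s = 2 * pi * m + 2 * pi - arccos (- (4 * s / sinh s))" for s
  have cosy: "cos (y s) = - (4 * s / sinh s)" and siny: "sin (y s) = - sqrt (1 - (4 * s / sinh s)\<^sup>2)"
    and y_ge: "y s \<ge> 2 * pi * m + pi" and y_le: "y s \<le> 2 * pi * m + 2 * pi" if "s \<ge> s1" for s
  proof -
    have b: "-1 \<le> - (4 * s / sinh s)" "- (4 * s / sinh s) \<le> 1" using half[OF that] by linarith+
    have e: "y s = - arccos (- (4 * s / sinh s)) + 2 * real (m + 1) * pi" by (simp add: y_def algebra_simps)
    have "cos (y s) = cos (- arccos (- (4 * s / sinh s)))"
      unfolding e by (simp only: cos_add cos_2npi sin_2npi mult_1_right mult_zero_right diff_zero)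
    then show "cos (y s) = - (4 * s / sinh s)" using b by simp
    have "sin (y s) = sin (- arccos (- (4 * s / sinh s)))"
      unfolding e by (simp only: sin_add cos_2npi sin_2npi mult_1_right mult_zero_right add_0_right)
    then show "sin (y s) = - sqrt (1 - (4 * s / sinh s)\<^sup>2)" using b by (simp add: sin_arccos)
    show "y s \<ge> 2 * pi * m + pi" "y s \<le> 2 * pi * m + 2 * pi"
      using arccos_bounded[OF b] by (auto simp: y_def)
  qed
  define G where "G s = 4 * y s + cosh s * sin (y s)" for s
  have "eventually (\<lambda>s::real. cosh s \<ge> 8 * (2 * pi * m + 2 * pi)) at_top"
    by real_asymp
  then obtain r2 where r2: "\<And>s::real. s \<ge> r2 \<Longrightarrow> cosh s \<ge> 8 * (2 * pi * m + 2 * pi)"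
    unfolding eventually_at_top_linorder by blast
  define s2 where "s2 = max s1 r2"
  have s12: "s1 \<le> s2" by (simp add: s2_def)
  have "G s2 \<le> 0"
  proof -
    have "(4 * s2 / sinh s2)\<^sup>2 \<le> (1 / 2)\<^sup>2"
      using half[OF s12] by (intro power_mono)
    then have "(1/2)\<^sup>2 \<le> 1 - (4 * s2 / sinh s2)\<^sup>2" by (simp add: power2_eq_square)
    then have "1 / 2 \<le> sqrt (1 - (4 * s2 / sinh s2)\<^sup>2)" by (rule real_le_rsqrt)
    then have "sin (y s2) \<le> - (1 / 2)" using siny[OF s12] by simp
    then have "cosh s2 * sin (y s2) \<le> cosh s2 * (- (1 / 2))" by (intro mult_left_mono) auto
    then have "cosh s2 * sin (y s2) \<le> - (cosh s2 / 2)" by simp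
    moreover have "cosh s2 \<ge> 8 * (2 * pi * m + 2 * pi)" by (rule r2) (simp add: s2_def)
    moreover define M where "M = 2 * pi * m + 2 * pi"
    ultimately show ?thesis using y_le[OF s12] unfolding G_def M_def[symmetric] by linarith
  qed
  moreover have "G s1 \<ge> 0"
  proof -
    have "cosh s1 * (-1) \<le> cosh s1 * sin (y s1)" by (intro mult_left_mono) auto
    moreover have "cosh s1 \<le> y s1"
    proof -
      have "2 * pi * m \<le> 2 * pi * m + pi" by simp
      with m(1) y_ge[of s1] show ?thesis by (meson order_refl order_trans)
    qed
    ultimately show ?thesis using cosh_real_ge_1[of s1] unfolding G_def by linarith
  qed
  moreover have "continuous_on {s1..s2} G"
  proof -
    have "sinh s \<noteq> 0" "-1 \<le> - (4 * s / sinh s)" "- (4 * s / sinh s) \<le> 1" if "s \<in> {s1..s2}" for s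
    proof -
      have "s1 \<le> s" using that by simp
      from half[OF this] show "sinh s \<noteq> 0" "-1 \<le> - (4 * s / sinh s)" "- (4 * s / sinh s) \<le> 1"
        by linarith+
    qed
    then show ?thesis
      unfolding G_def y_def by (intro continuous_intros) auto
  qed
  ultimately obtain s where s: "s1 \<le> s" "s \<le> s2" "G s = 0"
    using IVT2'[of G s2 0 s1] s12 by auto
  define p where "p = (vector [- s, y s] :: real^2)"
  have s0: "s > 0" using s by (simp add: s1_def)
  have "saddle p = 0"
  proof -
    have "4 * - s + sinh (- s) * cos (y s) = 0"
      using half(3)[OF s(1)] cosy[OF s(1)] by simp
    moreover have "4 * y s + cosh (- s) * sin (y s) = 0" using s(3) by (simp add: G_def)
    ultimately show ?thesis
      using s0 by (simp add: saddle_def p_def vec_eq_iff forall_2)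
  qed
  moreover have "norm p \<ge> n"
  proof -
    have "real n \<le> real m" using m by simp
    also have "\<dots> \<le> 2 * pi * real m" using pi_gt3 mult_right_mono[of 1 "2 * pi" "real m"] by simp
    also have "\<dots> \<le> y s" using y_ge[OF s(1)] pi_gt_zero by linarith
    also have "\<dots> \<le> \<bar>p $ 2\<bar>" by (simp add: p_def)
    also have "\<dots> \<le> norm p" by (rule component_le_norm_cart)
    finally show ?thesis .
  qed
  ultimately show ?thesis by blast
qed

text \<open>No limit can exist, finite or infinite: the map vanishes along a sequence of zeros tending to
  infinity but is unbounded on the vertical axis.\<close>

theorem saddle_essential: "essential_singularity_at_infinity saddle"
proof -
  obtain z where z: "\<And>n. norm (z n) \<ge> real n" "\<And>n. saddle (z n) = 0"
    using saddle_zero_far_out by metis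
  have z_inf: "filterlim z at_infinity sequentially"
    unfolding filterlim_at_infinity_conv_norm_at_top
    by (rule filterlim_at_top_mono[OF filterlim_real_sequentially]) (simp add: z)
  define w where "w n = (vector [0, real n] :: real^2)" for n
  have w: "norm (w n) \<ge> real n" for n
    using component_le_norm_cart[of "w n" 2] by (simp add: w_def)
  have w_inf: "filterlim w at_infinity sequentially"
    unfolding filterlim_at_infinity_conv_norm_at_top
    by (rule filterlim_at_top_mono[OF filterlim_real_sequentially]) (simp add: w)
  have sw: "norm (saddle (w n)) \<ge> 3 * real n" for n
  proof -
    have "\<bar>sin (real n)\<bar> \<le> real n" using abs_sin_x_le_abs_x[of "real n"] by simp
    then have "3 * real n \<le> \<bar>saddle (w n) $ 2\<bar>"
      by (simp add: saddle_axis w_def)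
    also have "\<dots> \<le> norm (saddle (w n))" by (rule component_le_norm_cart)
    finally show ?thesis .
  qed
  have nonconst: "\<not> saddle constant_on UNIV"
  proof
    assume "saddle constant_on UNIV"
    then have "saddle (w 1) = saddle (z 0)" unfolding constant_on_def by auto
    then show False using sw[of 1] z(2)[of 0] by simp
  qed
  moreover have "\<not> filterlim saddle at_infinity at_infinity"
  proof
    assume "filterlim saddle at_infinity at_infinity"
    from filterlim_compose[OF this z_inf] have "filterlim (\<lambda>n. 0 :: real^2) at_infinity sequentially"
      by (simp add: z(2))
    then show False
      using not_tendsto_and_filterlim_at_infinity[of sequentially "\<lambda>n. 0 :: real^2" 0] by simp
  qed
  moreover have "\<not> (saddle \<longlongrightarrow> l) at_infinity" for l
  proof
    assume "(saddle \<longlongrightarrow> l) at_infinity"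
    from filterlim_compose[OF this w_inf] have l: "(\<lambda>n. saddle (w n)) \<longlonglongrightarrow> l" .
    have "filterlim (\<lambda>n. saddle (w n)) at_infinity sequentially"
      unfolding filterlim_at_infinity_conv_norm_at_top
    proof (rule filterlim_at_top_mono[OF filterlim_real_sequentially], rule always_eventually, rule allI)
      show "real n \<le> norm (saddle (w n))" for n using sw[of n] by simp
    qed
    then show False
      using not_tendsto_and_filterlim_at_infinity[OF _ l] by simp
  qed
  ultimately show ?thesis
    unfolding essential_singularity_at_infinity_def polynomial_type_def
    using saddle_quasiregular by blast
qed

section \<open>Escaping points and normality\<close>

lemma open_connected_in_components:
  assumes W: "open W" "connected W" "W \<noteq> {}" "W \<subseteq> U" and cl: "closure W \<inter> U \<subseteq> W"
  shows "W \<in> components U"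
proof -
  obtain x where x: "x \<in> W" using W by blast
  define C where "C = connected_component_set U x"
  have WC: "W \<subseteq> C"
    unfolding C_def using x W by (intro connected_component_maximal)
  have CU: "C \<subseteq> U" unfolding C_def by (rule connected_component_subset)
  have "W = C \<inter> W" "W = C \<inter> closure W"
    using WC CU cl closure_subset[of W] by blast+
  then have "openin (top_of_set C) W" "closedin (top_of_set C) W"
    using W(1) by (metis openin_open_Int, metis closed_closure closedin_closed_Int)
  then have "W = C"
    using W(3) connected_connected_component[of U x] unfolding C_def connected_clopen by blast
  then show ?thesis
    unfolding components_def C_def using x W by blast
qed

lemma continuous_to_sphere: "continuous_on UNIV to_sphere"
  unfolding to_sphere_def by (intro continuous_intros) (auto simp: add_nonneg_eq_0_iff)

lemma to_sphere_at_infinity: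
  assumes "filterlim X at_infinity F"
  shows "((\<lambda>n. to_sphere (X n)) \<longlongrightarrow> (0, 1)) F"
proof -
  have n: "filterlim (\<lambda>n. norm (X n)) at_top F"
    using assms by (rule filterlim_at_infinity_imp_norm_at_top)
  have "((\<lambda>r::real. 2 * r / (r\<^sup>2 + 1)) \<longlongrightarrow> 0) at_top" by real_asymp
  from filterlim_compose[OF this n]
  have "((\<lambda>n. norm ((2 / ((norm (X n))\<^sup>2 + 1)) *\<^sub>R X n)) \<longlongrightarrow> 0) F"
    by (simp add: add_nonneg_nonneg abs_of_nonneg)
  then have "((\<lambda>n. (2 / ((norm (X n))\<^sup>2 + 1)) *\<^sub>R X n) \<longlongrightarrow> 0) F"
    by (rule tendsto_norm_zero_cancel)
  moreover have "((\<lambda>r::real. (r\<^sup>2 - 1) / (r\<^sup>2 + 1)) \<longlongrightarrow> 1) at_top" by real_asymp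
  from filterlim_compose[OF this n]
  have "((\<lambda>n. ((norm (X n))\<^sup>2 - 1) / ((norm (X n))\<^sup>2 + 1)) \<longlongrightarrow> 1) F" .
  ultimately show ?thesis
    unfolding to_sphere_def by (rule tendsto_Pair)
qed

lemma continuous_funpow:
  fixes f :: "'a::topological_space \<Rightarrow> 'a"
  assumes "continuous_on UNIV f"
  shows "continuous_on UNIV (f ^^ n)"
proof (induction n)
  case (Suc n)
  have "continuous_on UNIV (\<lambda>x. f ((f ^^ n) x))"
    by (rule continuous_on_compose2[OF assms Suc]) simp
  then show ?case by (simp add: o_def)
qed (simp add: id_def)

text \<open>A sequence of iterates either repeats one iterate infinitely often or has exponents tending
  to infinity; in the second case it inherits the uniform limit.\<close>

lemma uniform_limit_subset_fatou:
  assumes W: "open W" and lim: "uniform_limit W (\<lambda>n. f ^^ n) (\<lambda>_. l) sequentially"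
  shows "W \<subseteq> fatou_set f"
proof
  fix x assume x: "x \<in> W"
  have U: "uniform_limit W (\<lambda>n y. to_sphere ((f ^^ n) y)) (\<lambda>_. to_sphere l) sequentially"
  proof (rule uniform_limitI)
    fix e :: real assume "e > 0"
    then obtain d where d: "d > 0" "\<And>y. dist y l < d \<Longrightarrow> dist (to_sphere y) (to_sphere l) < e"
      using continuous_to_sphere unfolding continuous_on_iff by (metis UNIV_I)
    from uniform_limitD[OF lim d(1)]
    show "\<forall>\<^sub>F n in sequentially. \<forall>y\<in>W. dist (to_sphere ((f ^^ n) y)) (to_sphere l) < e"
      by eventually_elim (use d in auto)
  qed
  have "normal_family_on W (range (\<lambda>n. f ^^ n))"
    unfolding normal_family_on_def
  proof (intro allI impI)
    fix h :: "nat \<Rightarrow> real^2 \<Rightarrow> real^2" assume "range h \<subseteq> range (\<lambda>n. f ^^ n)"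
    then have "\<forall>k. \<exists>n. h k = f ^^ n" by blast
    then obtain m where m: "\<And>k. h k = f ^^ m k" by metis
    have "\<exists>r g. strict_mono (r :: nat \<Rightarrow> nat) \<and> uniform_limit W (\<lambda>k y. to_sphere (h (r k) y)) g sequentially"
    proof (cases "\<exists>n. infinite {k. m k = n}")
      case True
      then obtain n where n: "infinite {k. m k = n}" by blast
      have "h (enumerate {k. m k = n} k) = f ^^ n" for k
        using enumerate_in_set[OF n, of k] m by simp
      then have "uniform_limit W (\<lambda>k y. to_sphere (h (enumerate {k. m k = n} k) y)) (\<lambda>y. to_sphere ((f ^^ n) y)) sequentially"
        by (simp add: uniform_limit_const)
      then show ?thesis using strict_mono_enumerate[OF n] by blast
    next
      case False
      have "filterlim m at_top sequentially"
        unfolding filterlim_at_top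
      proof
        fix Z
        have "{k. m k < Z} = (\<Union>n<Z. {k. m k = n})" by auto
        then have "finite {k. m k < Z}" using False by simp
        then have "\<forall>\<^sub>F k in cofinite. k \<notin> {k. m k < Z}"
          by (simp add: eventually_cofinite)
        then show "\<forall>\<^sub>F k in sequentially. Z \<le> m k"
          by (simp add: cofinite_eq_sequentially not_less)
      qed
      then have "uniform_limit W (\<lambda>k y. to_sphere (h (id k) y)) (\<lambda>_. to_sphere l) sequentially"
        using filterlim_compose[OF U, of m sequentially] by (simp add: m)
      then show ?thesis using strict_mono_id by blast
    qed
    then show "\<exists>r g. strict_mono (r :: nat \<Rightarrow> nat) \<and> (\<forall>x\<in>W. \<exists>V. open V \<and> x \<in> V \<and> V \<subseteq> W \<and>
              uniform_limit V (\<lambda>k y. to_sphere (h (r k) y)) g sequentially)"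
      using W by blast
  qed
  then show "x \<in> fatou_set f" unfolding fatou_set_def using W x by blast
qed

text \<open>A locally uniform limit of iterates on the sphere would be continuous, yet at \<open>p\<close> it would
  have to equal both the point at infinity and the image of \<open>l\<close>. This makes the boundary of a set of convergence
  that is accumulated by escaping points a boundary of the Fatou set as well.\<close>

lemma not_fatou_of_escaping_and_bounded:
  assumes f: "continuous_on UNIV f"
    and esc: "p \<in> closure (escaping_set f)"
    and bdd: "p \<in> closure {x. (\<lambda>n. (f ^^ n) x) \<longlonglongrightarrow> l}"
  shows "p \<notin> fatou_set f"
proof
  assume "p \<in> fatou_set f"
  then obtain U where U: "p \<in> U" "normal_family_on U (range (\<lambda>n. f ^^ n))"
    unfolding fatou_set_def by blast
  from U(2)[unfolded normal_family_on_def, rule_format, of "\<lambda>n. f ^^ n", OF subset_refl]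
  obtain r g where r: "strict_mono (r :: nat \<Rightarrow> nat)"
    and loc: "\<forall>x\<in>U. \<exists>V. open V \<and> x \<in> V \<and> V \<subseteq> U \<and>
      uniform_limit V (\<lambda>k y. to_sphere ((f ^^ r k) y)) g sequentially"
    by blast
  from bspec[OF loc U(1)] obtain V where V: "open V" "p \<in> V"
    and lim: "uniform_limit V (\<lambda>k y. to_sphere ((f ^^ r k) y)) g sequentially"
    by blast
  have cg: "continuous_on V g"
  proof (rule uniform_limit_theorem[OF _ lim])
    show "\<forall>\<^sub>F k in sequentially. continuous_on V (\<lambda>y. to_sphere ((f ^^ r k) y))"
    proof (intro always_eventually allI)
      show "continuous_on V (\<lambda>y. to_sphere ((f ^^ r k) y))" for k
        by (rule continuous_on_compose2[OF continuous_to_sphere continuous_on_subset[OF continuous_funpow[OF f]]]) auto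
    qed
  qed simp
  have ptw: "g p = c" if S: "p \<in> closure S" and c: "\<And>x. x \<in> S \<Longrightarrow> (\<lambda>n. to_sphere ((f ^^ n) x)) \<longlonglongrightarrow> c" for S c
  proof -
    have "g x = c" if "x \<in> V \<inter> S" for x
    proof (rule LIMSEQ_unique)
      show "(\<lambda>k. to_sphere ((f ^^ r k) x)) \<longlonglongrightarrow> g x"
        using tendsto_uniform_limitI[OF lim] that by blast
      show "(\<lambda>k. to_sphere ((f ^^ r k) x)) \<longlonglongrightarrow> c"
        using LIMSEQ_subseq_LIMSEQ[OF c r] that by (simp add: o_def)
    qed
    moreover have "p \<in> closure (V \<inter> S)"
      using S V open_Int_closure_subset by blast
    then obtain y where y: "\<And>n. y n \<in> V \<inter> S" "y \<longlonglongrightarrow> p"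
      unfolding closure_sequential by blast
    moreover have "(\<lambda>n. g (y n)) \<longlonglongrightarrow> g p"
      using continuous_on_tendsto_compose[OF cg y(2) V(2)] y(1) by simp
    ultimately have "(\<lambda>n::nat. c) \<longlonglongrightarrow> g p" by simp
    then show ?thesis by (simp add: LIMSEQ_const_iff)
  qed
  have "g p = (0, 1)"
    by (rule ptw[OF esc]) (simp add: escaping_set_def to_sphere_at_infinity)
  moreover have "g p = to_sphere l"
  proof (rule ptw[OF bdd])
    show "(\<lambda>n. to_sphere ((f ^^ n) x)) \<longlonglongrightarrow> to_sphere l" if "x \<in> {x. (\<lambda>n. (f ^^ n) x) \<longlonglongrightarrow> l}" for x
      using that continuous_on_tendsto_compose[OF continuous_to_sphere, of "\<lambda>n. (f ^^ n) x" l] by simp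
  qed
  moreover have "to_sphere l \<noteq> (0, 1)"
    by (simp add: to_sphere_def divide_eq_eq add_nonneg_eq_0_iff)
  ultimately show False by simp
qed

section \<open>The lenses as wandering domains\<close>

definition lens :: "nat \<Rightarrow> (real^2) set" where
  "lens k = {p. shrink ^ Suc k < p $ 1 \<and> p $ 1 < shrink ^ k \<and> \<bar>p $ 2\<bar> < height (p $ 1)}"

lemma saddle_inside:
  assumes "p $ 1 \<ge> 0" "\<bar>p $ 2\<bar> \<le> height (p $ 1)"
  shows "saddle p = shrink *\<^sub>R p"
  using assms by (simp add: vec_eq_iff forall_2 saddle_nth push_nonpos)

lemma saddle_outside:
  assumes a: "p $ 1 \<ge> 0" and b: "\<bar>p $ 2\<bar> > height (p $ 1)"
  shows "saddle p $ 1 = shrink * p $ 1"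
    "\<bar>saddle p $ 2\<bar> - height (saddle p $ 1) \<ge> 3 * (\<bar>p $ 2\<bar> - height (p $ 1))"
proof -
  show 1: "saddle p $ 1 = shrink * p $ 1" using a by (simp add: saddle_nth)
  have 2: "saddle p $ 2 = shrink * p $ 2 + push (p $ 2 - height (p $ 1)) - push (- p $ 2 - height (p $ 1))"
    using a by (simp add: saddle_nth)
  have h: "height (p $ 1) \<ge> 0" by (rule height_nonneg)
  show "\<bar>saddle p $ 2\<bar> - height (saddle p $ 1) \<ge> 3 * (\<bar>p $ 2\<bar> - height (p $ 1))"
  proof (cases "p $ 2 > 0")
    case True
    then have "saddle p $ 2 \<ge> shrink * p $ 2 + (3 - shrink) * (p $ 2 - height (p $ 1))"
      unfolding 2 using h b push_ge[of "p $ 2 - height (p $ 1)"] by (simp add: push_nonpos)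
    then show ?thesis unfolding 1 height_shrink using True by (simp add: algebra_simps)
  next
    case False
    then have "- saddle p $ 2 \<ge> shrink * (- p $ 2) + (3 - shrink) * (- p $ 2 - height (p $ 1))"
      unfolding 2 using h b push_ge[of "- p $ 2 - height (p $ 1)"] by (simp add: push_nonpos)
    then show ?thesis unfolding 1 height_shrink using False by (simp add: algebra_simps)
  qed
qed

text \<open>The vertical distance from the chain of lenses at least triples with every step, while the point stays in
  the right half-plane, where this estimate applies again.\<close>

lemma outside_escapes:
  assumes a: "p $ 1 \<ge> 0" and b: "\<bar>p $ 2\<bar> > height (p $ 1)"
  shows "p \<in> escaping_set saddle"
proof -
  define e where "e = \<bar>p $ 2\<bar> - height (p $ 1)"
  have e: "e > 0" using b by (simp add: e_def)
  have *: "((saddle ^^ n) p) $ 1 \<ge> 0 \<and> \<bar>((saddle ^^ n) p) $ 2\<bar> - height (((saddle ^^ n) p) $ 1) \<ge> 3 ^ n * e" for n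
  proof (induction n)
    case 0
    then show ?case using a by (simp add: e_def)
  next
    case (Suc n)
    define q where "q = (saddle ^^ n) p"
    have IH: "q $ 1 \<ge> 0" "\<bar>q $ 2\<bar> - height (q $ 1) \<ge> 3 ^ n * e"
      using Suc by (auto simp: q_def)
    have "3 ^ n * e > 0" using e by simp
    with IH have "\<bar>q $ 2\<bar> > height (q $ 1)" by linarith
    from saddle_outside[OF IH(1) this] IH show ?case
      using shrink_pos by (simp add: q_def[symmetric])
  qed
  have "filterlim (\<lambda>n. norm ((saddle ^^ n) p)) at_top sequentially"
  proof (rule filterlim_at_top_mono)
    show "filterlim (\<lambda>n. 3 ^ n * e) at_top sequentially"
      using e by real_asymp
    have "3 ^ n * e \<le> norm ((saddle ^^ n) p)" for n
      using *[of n] height_nonneg[of "((saddle ^^ n) p) $ 1"] component_le_norm_cart[of "(saddle ^^ n) p" 2]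
      by linarith
    then show "\<forall>\<^sub>F n in sequentially. 3 ^ n * e \<le> norm ((saddle ^^ n) p)" by simp
  qed
  then show ?thesis
    by (simp add: escaping_set_def filterlim_at_infinity_conv_norm_at_top)
qed

lemma shrink_power: "shrink ^ k = exp (- (2 * pi * real k))"
  by (simp add: shrink_def exp_of_nat_mult[symmetric] mult_ac)

lemma height_power: "height (shrink ^ k) = 0"
  by (induction k) (simp_all add: height_shrink, simp add: height_def)

text \<open>The zeros of \<open>height\<close> on the positive axis are the points whose logarithm is an integral multiple of
  \<open>2 * pi\<close>, and none of them lies strictly between two consecutive powers of \<open>shrink\<close>.\<close>

lemma height_pos:
  assumes "shrink ^ Suc k < a" "a < shrink ^ k"
  shows "height a > 0"
proof -
  have a: "a > 0" using assms(1) zero_less_power[OF shrink_pos, of "Suc k"] by linarith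
  have "cos (ln a) \<noteq> 1"
  proof
    assume "cos (ln a) = 1"
    then obtain n :: int where n: "ln a = real_of_int n * 2 * pi"
      unfolding cos_one_2pi_int by auto
    have "exp (- (2 * pi * real (Suc k))) < exp (ln a)" "exp (ln a) < exp (- (2 * pi * real k))"
      using assms a unfolding shrink_power by simp_all
    then have b: "- (2 * pi * real (Suc k)) < ln a" "ln a < - (2 * pi * real k)"
      by (simp_all only: exp_less_cancel_iff)
    have cancel: "x < y" if "2 * pi * x < 2 * pi * y" for x y
      using that by (simp add: mult_less_cancel_left_pos)
    have "- real (Suc k) < n"
      by (rule cancel) (use b(1)[unfolded n] in \<open>simp only: mult_minus_right mult_ac\<close>)
    moreover have "n < - real k"
      by (rule cancel) (use b(2)[unfolded n] in \<open>simp only: mult_minus_right mult_ac\<close>)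
    ultimately have "- int (Suc k) < n \<and> n < - int k" by linarith
    then show False by linarith
  qed
  then have "cos (ln a) < 1" using cos_le_one[of "ln a"] by linarith
  then show ?thesis using a by (simp add: height_def)
qed

lemma lens_nonneg: "p \<in> lens k \<Longrightarrow> p $ 1 > 0"
  using zero_less_power[OF shrink_pos, of "Suc k"] by (auto simp: lens_def)

lemma open_lens: "open (lens k)"
proof -
  have "continuous_on UNIV (\<lambda>p :: real^2. height (p $ 1))"
    by (rule continuous_on_compose2[OF lipschitz_on_balls_continuous[OF lipschitz_on_balls_height]])
       (auto intro!: continuous_intros)
  then show ?thesis
    unfolding lens_def by (intro open_Collect_conj open_Collect_less continuous_intros) auto
qed

text \<open>Straightening the vertical fibres presents the lens as a continuous image of a rectangle.\<close>

lemma connected_lens: "connected (lens k)"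
proof -
  define g where "g q = (vector [fst q, snd q * height (fst q)] :: real^2)" for q :: "real \<times> real"
  define B where "B = {shrink ^ Suc k <..< shrink ^ k} \<times> {-1 <..< 1 :: real}"
  have "continuous_on B (\<lambda>q. height (fst q))"
    by (rule continuous_on_compose2[OF lipschitz_on_balls_continuous[OF lipschitz_on_balls_height]])
       (auto intro!: continuous_intros)
  then have "continuous_on B (\<lambda>q. g q $ i)" for i
    using exhaust_2[of i] by (elim disjE) (simp_all add: g_def continuous_intros)
  then have "continuous_on B (\<lambda>q. \<chi> i. g q $ i)" by (rule continuous_on_vec_lambda)
  then have "continuous_on B g" by simp
  moreover have "connected B"
    unfolding B_def by (intro convex_connected convex_Times convex_real_interval)
  ultimately have "connected (g ` B)" by (rule connected_continuous_image)
  moreover have "g ` B = lens k"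
  proof
    show "g ` B \<subseteq> lens k"
    proof
      fix p assume "p \<in> g ` B"
      then obtain a t where *: "p = g (a, t)" "shrink ^ Suc k < a" "a < shrink ^ k" "\<bar>t\<bar> < 1"
        unfolding B_def by auto
      have "\<bar>t * height a\<bar> < height a"
        using *(4) height_pos[OF *(2,3)] by (simp add: abs_mult)
      then show "p \<in> lens k" using * by (simp add: lens_def g_def)
    qed
    show "lens k \<subseteq> g ` B"
    proof
      fix p assume p: "p \<in> lens k"
      then have h: "height (p $ 1) > 0" by (auto simp: lens_def)
      have "p = g (p $ 1, p $ 2 / height (p $ 1))"
        using h by (simp add: g_def vec_eq_iff forall_2)
      moreover have "(p $ 1, p $ 2 / height (p $ 1)) \<in> B"
        using p h by (auto simp: B_def lens_def pos_divide_less_eq pos_less_divide_eq abs_less_iff)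
      ultimately show "p \<in> g ` B" by blast
    qed
  qed
  ultimately show ?thesis by simp
qed

lemma lens_nonempty: "lens k \<noteq> {}"
proof -
  obtain a where a: "shrink ^ Suc k < a" "a < shrink ^ k"
    using dense[of "shrink ^ Suc k" "shrink ^ k"] power_Suc_less[OF shrink_pos shrink_less_1, of k]
    by auto
  then have "(vector [a, 0] :: real^2) \<in> lens k"
    using height_pos[OF a] by (simp add: lens_def)
  then show ?thesis by blast
qed

lemma scale_lens: "shrink *\<^sub>R p \<in> lens (Suc k) \<longleftrightarrow> p \<in> lens k"
  using shrink_pos by (simp add: lens_def height_shrink abs_mult)

lemma saddle_lens: "p \<in> lens k \<Longrightarrow> saddle p = shrink *\<^sub>R p"
  by (rule saddle_inside) (use lens_nonneg[of p k] in \<open>auto simp: lens_def\<close>)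

lemma saddle_image_lens: "saddle ` lens k = lens (Suc k)"
proof
  show "saddle ` lens k \<subseteq> lens (Suc k)"
    using saddle_lens scale_lens by auto
  show "lens (Suc k) \<subseteq> saddle ` lens k"
  proof
    fix q assume q: "q \<in> lens (Suc k)"
    define p where "p = (1 / shrink) *\<^sub>R q"
    have qp: "q = shrink *\<^sub>R p" using shrink_pos by (simp add: p_def)
    with q have "p \<in> lens k" using scale_lens by simp
    with qp saddle_lens show "q \<in> saddle ` lens k" by auto
  qed
qed

lemma funpow_image_lens: "(saddle ^^ n) ` lens k = lens (k + n)"
proof (induction n)
  case (Suc n)
  have "(saddle ^^ Suc n) ` lens k = saddle ` (saddle ^^ n) ` lens k"
    by (simp add: image_comp)
  with Suc show ?case by (simp add: saddle_image_lens)
qed simp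

lemma funpow_lens: "p \<in> lens k \<Longrightarrow> (saddle ^^ n) p = shrink ^ n *\<^sub>R p"
proof (induction n)
  case (Suc n)
  then have "(saddle ^^ n) p \<in> lens (k + n)" using funpow_image_lens by blast
  from saddle_lens[OF this] Suc show ?case by simp
qed simp

lemma lens_norm_le: "p \<in> lens k \<Longrightarrow> norm p \<le> 3"
proof -
  assume p: "p \<in> lens k"
  have "norm p \<le> \<bar>p $ 1\<bar> + \<bar>p $ 2\<bar>"
    using norm_le_l1_cart[of p] by (simp add: sum_2)
  moreover have "0 < p $ 1" using p by (rule lens_nonneg)
  moreover have "p $ 1 < 1"
    using p power_le_one[of shrink k] shrink_pos shrink_less_1 unfolding lens_def by auto
  moreover have "\<bar>p $ 2\<bar> < 2 * p $ 1"
    using p height_le[of "p $ 1"] \<open>0 < p $ 1\<close> unfolding lens_def by auto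
  ultimately show ?thesis by linarith
qed

lemma uniform_limit_lens: "uniform_limit (lens k) (\<lambda>n. saddle ^^ n) (\<lambda>_. 0) sequentially"
proof (rule uniform_limitI)
  fix e :: real assume "e > 0"
  have "(\<lambda>n. shrink ^ n * 3) \<longlonglongrightarrow> 0 * 3"
    using shrink_pos shrink_less_1 by (intro tendsto_mult LIMSEQ_realpow_zero tendsto_const) auto
  then have "\<forall>\<^sub>F n in sequentially. shrink ^ n * 3 < e"
    using order_tendstoD(2)[of _ "0 * 3" sequentially e] \<open>e > 0\<close> by simp
  then show "\<forall>\<^sub>F n in sequentially. \<forall>p\<in>lens k. dist ((saddle ^^ n) p) 0 < e"
  proof eventually_elim
    case (elim n)
    show ?case
    proof
      fix p assume p: "p \<in> lens k"
      have "shrink ^ n * norm p \<le> shrink ^ n * 3"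
        using lens_norm_le[OF p] shrink_pos by (intro mult_left_mono) auto
      with elim have "shrink ^ n * norm p < e" by linarith
      then show "dist ((saddle ^^ n) p) 0 < e"
        using shrink_pos by (simp add: funpow_lens[OF p])
    qed
  qed
qed

lemma disjoint_lens: "k \<noteq> m \<Longrightarrow> lens k \<inter> lens m = {}"
proof (induction k m rule: linorder_wlog)
  case (le k m)
  then have "Suc k \<le> m" by simp
  then have "shrink ^ m \<le> shrink ^ Suc k"
    using shrink_pos shrink_less_1 by (intro power_decreasing) auto
  then show ?case by (auto simp: lens_def)
qed auto

text \<open>A boundary point lies exactly on the graph of \<open>height\<close> or of its negative, also at the two tips, where
  \<open>height\<close> vanishes. Moving it vertically away from the axis by any small amount makes it escape.\<close>

lemma frontier_lens_escaping:
  assumes p: "p \<in> closure (lens k)" and np: "p \<notin> lens k"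
  shows "p \<in> closure (escaping_set saddle)"
proof -
  have "closed {p :: real^2. shrink ^ Suc k \<le> p $ 1 \<and> p $ 1 \<le> shrink ^ k \<and> \<bar>p $ 2\<bar> \<le> height (p $ 1)}"
  proof -
    have "continuous_on UNIV (\<lambda>p :: real^2. height (p $ 1))"
      by (rule continuous_on_compose2[OF lipschitz_on_balls_continuous[OF lipschitz_on_balls_height]])
         (auto intro!: continuous_intros)
    then show ?thesis
      by (intro closed_Collect_conj closed_Collect_le continuous_intros) auto
  qed
  then have "closure (lens k) \<subseteq> {p. shrink ^ Suc k \<le> p $ 1 \<and> p $ 1 \<le> shrink ^ k \<and> \<bar>p $ 2\<bar> \<le> height (p $ 1)}"
    by (rule closure_minimal[rotated]) (auto simp: lens_def)
  with p have le: "shrink ^ Suc k \<le> p $ 1" "p $ 1 \<le> shrink ^ k" "\<bar>p $ 2\<bar> \<le> height (p $ 1)" by auto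
  have nonneg: "p $ 1 \<ge> 0" using le(1) zero_less_power[OF shrink_pos, of "Suc k"] by linarith
  have eq: "\<bar>p $ 2\<bar> = height (p $ 1)"
  proof (cases "p $ 1 = shrink ^ Suc k \<or> p $ 1 = shrink ^ k")
    case True
    then have "height (p $ 1) = 0" using height_power by metis
    with le show ?thesis by simp
  next
    case False
    with le np show ?thesis by (auto simp: lens_def)
  qed
  define s where "s = (if p $ 2 \<ge> 0 then 1 else - 1 :: real)"
  define q where "q n = p + (s / real (Suc n)) *\<^sub>R axis 2 1" for n
  have q1: "q n $ 1 = p $ 1" for n by (simp add: q_def axis_def)
  have q2: "\<bar>q n $ 2\<bar> = \<bar>p $ 2\<bar> + 1 / real (Suc n)" for n
  proof -
    have "q n $ 2 = p $ 2 + s * (1 / real (Suc n))" by (simp add: q_def axis_def)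
    moreover have "1 / real (Suc n) \<ge> 0" by simp
    ultimately show ?thesis
      by (cases "p $ 2 \<ge> 0"; simp only: s_def if_True if_False; linarith)
  qed
  have "q n \<in> escaping_set saddle" for n
    using outside_escapes[of "q n"] nonneg eq by (simp add: q1 q2)
  moreover have "q \<longlonglongrightarrow> p"
  proof -
    have "(\<lambda>n. p + (s * inverse (real (Suc n))) *\<^sub>R axis 2 1) \<longlonglongrightarrow> p + (s * 0) *\<^sub>R axis 2 1"
      by (intro tendsto_intros LIMSEQ_inverse_real_of_nat)
    then show ?thesis by (simp add: q_def[abs_def] divide_inverse)
  qed
  ultimately show ?thesis unfolding closure_sequential by blast
qed

lemma lens_tendsto: "p \<in> lens k \<Longrightarrow> (\<lambda>n. (saddle ^^ n) p) \<longlonglongrightarrow> 0"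
  using tendsto_uniform_limitI[OF uniform_limit_lens] .

lemma lens_component_escaping: "lens k \<in> components (UNIV - closure (escaping_set saddle))"
proof (rule open_connected_in_components[OF open_lens connected_lens lens_nonempty])
  have "lens k \<inter> escaping_set saddle = {}"
    using lens_tendsto not_tendsto_and_filterlim_at_infinity[OF sequentially_bot]
    unfolding escaping_set_def by blast
  then show "lens k \<subseteq> UNIV - closure (escaping_set saddle)"
    using open_Int_closure_eq_empty[OF open_lens] by blast
  show "closure (lens k) \<inter> (UNIV - closure (escaping_set saddle)) \<subseteq> lens k"
    using frontier_lens_escaping by blast
qed

lemma lens_component_fatou: "lens k \<in> components (fatou_set saddle)"
proof (rule open_connected_in_components[OF open_lens connected_lens lens_nonempty])
  show "lens k \<subseteq> fatou_set saddle"
    by (rule uniform_limit_subset_fatou[OF open_lens uniform_limit_lens])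
  have "lens k \<subseteq> {x. (\<lambda>n. (saddle ^^ n) x) \<longlonglongrightarrow> 0}" using lens_tendsto by blast
  from closure_mono[OF this] show "closure (lens k) \<inter> fatou_set saddle \<subseteq> lens k"
    using frontier_lens_escaping not_fatou_of_escaping_and_bounded[OF continuous_saddle] by blast
qed

lemma lens_wandering:
  assumes "\<And>k. lens k \<in> components U"
  shows "wandering_component saddle U (lens k)"
  unfolding wandering_component_def
proof (intro conjI exI[of _ "\<lambda>n. lens (k + n)"] allI impI)
  show "lens (k + n) \<noteq> lens (k + m)" if "n \<noteq> m" for n m
    using that disjoint_lens[of "k + n" "k + m"] lens_nonempty[of "k + n"] by auto
qed (simp_all add: assms funpow_image_lens)

theorem mainTheorem2:
  "\<exists>(f :: real^2 \<Rightarrow> real^2) (W :: nat \<Rightarrow> (real^2) set).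
     quasiregular_on UNIV f \<and>
     essential_singularity_at_infinity f \<and>
     (\<forall>k. is_domain (W k)) \<and>
     (\<forall>k. wandering_component f (UNIV - closure (escaping_set f)) (W k) \<and>
          wandering_component f (fatou_set f) (W k)) \<and>
     bounded (\<Union>k. W k) \<and>
     (\<forall>k. f ` W k = W (Suc k)) \<and>
     (\<forall>k. uniform_limit (W k) (\<lambda>n. f ^^ n) (\<lambda>_. 0) sequentially)"
proof (intro exI[of _ saddle] exI[of _ lens] conjI allI)
  show "is_domain (lens k)" for k
    using open_lens connected_lens lens_nonempty by (simp add: is_domain_def)
  show "wandering_component saddle (UNIV - closure (escaping_set saddle)) (lens k)" for k
    by (rule lens_wandering[OF lens_component_escaping])
  show "wandering_component saddle (fatou_set saddle) (lens k)" for k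
    by (rule lens_wandering[OF lens_component_fatou])
  show "bounded (\<Union>k. lens k)"
    unfolding bounded_iff using lens_norm_le by blast
qed (rule saddle_quasiregular saddle_essential saddle_image_lens uniform_limit_lens)+

end
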